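(* Let $K$ be an arbitrary field, $R$ a $K$-algebra, and $J$ an ideal of $R$. If $J$ is locally unit-regular and $R/J$ is locally f.d.ss, then $R$ is locally unit-regular. In particular, every extension of a locally f.d.ss $K$-algebra by a locally f.d.ss $K$-algebra is locally unit-regular.
   Context: Algebras are associative, not necessarily unital $K$-algebras; ideals are two-sided ring ideals that are $K$-subspaces. A $K$-algebra $R$ is locally f.d.ss if every finite subset of $R$ is contained in a subalgebra of $R$ that is a finite dimensional semisimple $K$-algebra. A unital ring $S$ is unit-regular if for each $x\in S$ there is a unit $u$ of $S$ with $xux = x$. A $K$-algebra $R$ is locally unit-regular if every finite subset of $R$ is contained in a $K$-subalgebra of $R$ that has its own identity element and is unit-regular. An extension of $A$ by $C$ is an algebra $B$ with an ideal $J \cong A$ and $B/J \cong C$. *)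

theory Defs
  imports Main
begin

text \<open>Associative, not necessarily unital K-algebras, given by an explicit carrier
and operations. The field K is the type class field on the scalar type 'k.\<close>

record ('k, 'a) alg =
  carrier :: "'a set"
  add :: "'a \<Rightarrow> 'a \<Rightarrow> 'a"
  mul :: "'a \<Rightarrow> 'a \<Rightarrow> 'a"
  zero :: "'a"
  smul :: "'k \<Rightarrow> 'a \<Rightarrow> 'a"

definition is_algebra :: "('k::field, 'a) alg \<Rightarrow> bool" where
  "is_algebra A \<longleftrightarrow>
     zero A \<in> carrier A \<and>
     (\<forall>x\<in>carrier A. \<forall>y\<in>carrier A. add A x y \<in> carrier A) \<and>
     (\<forall>x\<in>carrier A. \<forall>y\<in>carrier A. mul A x y \<in> carrier A) \<and>
     (\<forall>c. \<forall>x\<in>carrier A. smul A c x \<in> carrier A) \<and>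
     (\<forall>x\<in>carrier A. \<forall>y\<in>carrier A. \<forall>z\<in>carrier A. add A (add A x y) z = add A x (add A y z)) \<and>
     (\<forall>x\<in>carrier A. \<forall>y\<in>carrier A. add A x y = add A y x) \<and>
     (\<forall>x\<in>carrier A. add A (zero A) x = x) \<and>
     (\<forall>x\<in>carrier A. \<exists>y\<in>carrier A. add A x y = zero A) \<and>
     (\<forall>c. \<forall>x\<in>carrier A. \<forall>y\<in>carrier A. smul A c (add A x y) = add A (smul A c x) (smul A c y)) \<and>
     (\<forall>c d. \<forall>x\<in>carrier A. smul A (c + d) x = add A (smul A c x) (smul A d x)) \<and>
     (\<forall>c d. \<forall>x\<in>carrier A. smul A (c * d) x = smul A c (smul A d x)) \<and>
     (\<forall>x\<in>carrier A. smul A 1 x = x) \<and>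
     (\<forall>x\<in>carrier A. \<forall>y\<in>carrier A. \<forall>z\<in>carrier A. mul A (mul A x y) z = mul A x (mul A y z)) \<and>
     (\<forall>x\<in>carrier A. \<forall>y\<in>carrier A. \<forall>z\<in>carrier A. mul A x (add A y z) = add A (mul A x y) (mul A x z)) \<and>
     (\<forall>x\<in>carrier A. \<forall>y\<in>carrier A. \<forall>z\<in>carrier A. mul A (add A x y) z = add A (mul A x z) (mul A y z)) \<and>
     (\<forall>c. \<forall>x\<in>carrier A. \<forall>y\<in>carrier A.
        mul A (smul A c x) y = smul A c (mul A x y) \<and> mul A x (smul A c y) = smul A c (mul A x y))"

definition subalgebra :: "('k::field, 'a) alg \<Rightarrow> 'a set \<Rightarrow> bool" where
  "subalgebra A S \<longleftrightarrow> S \<subseteq> carrier A \<and> zero A \<in> S \<and>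
     (\<forall>x\<in>S. \<forall>y\<in>S. add A x y \<in> S) \<and>
     (\<forall>x\<in>S. \<forall>y\<in>S. mul A x y \<in> S) \<and>
     (\<forall>c. \<forall>x\<in>S. smul A c x \<in> S)"

definition alg_ideal :: "('k::field, 'a) alg \<Rightarrow> 'a set \<Rightarrow> bool" where
  "alg_ideal A I \<longleftrightarrow> I \<subseteq> carrier A \<and> zero A \<in> I \<and>
     (\<forall>x\<in>I. \<forall>y\<in>I. add A x y \<in> I) \<and>
     (\<forall>c. \<forall>x\<in>I. smul A c x \<in> I) \<and>
     (\<forall>r\<in>carrier A. \<forall>x\<in>I. mul A r x \<in> I \<and> mul A x r \<in> I)"

fun lincomb :: "('k, 'a) alg \<Rightarrow> ('k \<times> 'a) list \<Rightarrow> 'a" where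
  "lincomb A [] = zero A"
| "lincomb A ((c, v) # xs) = add A (smul A c v) (lincomb A xs)"

definition fin_dim :: "('k::field, 'a) alg \<Rightarrow> bool" where
  "fin_dim A \<longleftrightarrow> (\<exists>vs. set vs \<subseteq> carrier A \<and>
     (\<forall>x\<in>carrier A. \<exists>cs. length cs = length vs \<and> x = lincomb A (zip cs vs)))"

text \<open>Products of nonempty lists; an ideal I is nilpotent if I^n = 0 for some n \<ge> 1,
  i.e. all products of n elements of I vanish.\<close>
fun mprod :: "('k, 'a) alg \<Rightarrow> 'a list \<Rightarrow> 'a" where
  "mprod A [] = zero A"
| "mprod A [x] = x"
| "mprod A (x # y # ys) = mul A x (mprod A (y # ys))"

definition nilpotent_ideal :: "('k::field, 'a) alg \<Rightarrow> 'a set \<Rightarrow> bool" where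
  "nilpotent_ideal A I \<longleftrightarrow> alg_ideal A I \<and>
     (\<exists>n\<ge>1. \<forall>xs. length xs = n \<and> set xs \<subseteq> I \<longrightarrow> mprod A xs = zero A)"

text \<open>Finite dimensional semisimple: finite dimensional with zero (Wedderburn) radical,
  i.e. no nonzero nilpotent ideal.\<close>
definition fd_semisimple :: "('k::field, 'a) alg \<Rightarrow> bool" where
  "fd_semisimple A \<longleftrightarrow> fin_dim A \<and>
     (\<forall>I. nilpotent_ideal A I \<longrightarrow> I = {zero A})"

definition locally_fdss :: "('k::field, 'a) alg \<Rightarrow> bool" where
  "locally_fdss A \<longleftrightarrow> (\<forall>F. finite F \<and> F \<subseteq> carrier A \<longrightarrow>
     (\<exists>S. subalgebra A S \<and> F \<subseteq> S \<and> fd_semisimple (A\<lparr>carrier := S\<rparr>)))"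

definition unital_unit_regular :: "('k::field, 'a) alg \<Rightarrow> bool" where
  "unital_unit_regular A \<longleftrightarrow> (\<exists>e\<in>carrier A.
     (\<forall>x\<in>carrier A. mul A e x = x \<and> mul A x e = x) \<and>
     (\<forall>x\<in>carrier A. \<exists>u\<in>carrier A.
        (\<exists>v\<in>carrier A. mul A u v = e \<and> mul A v u = e) \<and> mul A (mul A x u) x = x))"

definition locally_unit_regular :: "('k::field, 'a) alg \<Rightarrow> bool" where
  "locally_unit_regular A \<longleftrightarrow> (\<forall>F. finite F \<and> F \<subseteq> carrier A \<longrightarrow>
     (\<exists>S. subalgebra A S \<and> F \<subseteq> S \<and> unital_unit_regular (A\<lparr>carrier := S\<rparr>)))"

definition coset :: "('k, 'a) alg \<Rightarrow> 'a set \<Rightarrow> 'a \<Rightarrow> 'a set" where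
  "coset A J x = {add A x j | j. j \<in> J}"

definition rep :: "'a set \<Rightarrow> 'a" where
  "rep C = (SOME x. x \<in> C)"

definition quotient_alg :: "('k::field, 'a) alg \<Rightarrow> 'a set \<Rightarrow> ('k, 'a set) alg" where
  "quotient_alg A J =
     \<lparr>carrier = coset A J ` carrier A,
      add = (\<lambda>C D. coset A J (add A (rep C) (rep D))),
      mul = (\<lambda>C D. coset A J (mul A (rep C) (rep D))),
      zero = coset A J (zero A),
      smul = (\<lambda>c C. coset A J (smul A c (rep C)))\<rparr>"

definition alg_iso :: "('k::field, 'a) alg \<Rightarrow> ('k, 'b) alg \<Rightarrow> ('a \<Rightarrow> 'b) \<Rightarrow> bool" where
  "alg_iso A B f \<longleftrightarrow> bij_betw f (carrier A) (carrier B) \<and>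
     (\<forall>x\<in>carrier A. \<forall>y\<in>carrier A. f (add A x y) = add B (f x) (f y) \<and>
                                    f (mul A x y) = mul B (f x) (f y)) \<and>
     (\<forall>c. \<forall>x\<in>carrier A. f (smul A c x) = smul B c (f x))"

definition is_extension :: "('k::field, 'a) alg \<Rightarrow> ('k, 'b) alg \<Rightarrow> ('k, 'c) alg \<Rightarrow> bool" where
  "is_extension A B C \<longleftrightarrow> is_algebra B \<and> (\<exists>J. alg_ideal B J \<and>
     (\<exists>f. alg_iso A (B\<lparr>carrier := J\<rparr>) f) \<and>
     (\<exists>g. alg_iso (quotient_alg B J) C g))"

end

theory Submission
  imports Defs
begin

text \<open>A finite dimensional algebra without nonzero nilpotent ideals is regular and unital, because its
  right ideals are generated by idempotents. It is unit-regular: among the inner inverses of \<open>x\<close>, one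
  with smallest kernel is a unit, since otherwise it could be altered on its kernel.

  Let \<open>F\<close> be a finite subset of \<open>R\<close>, and let \<open>D\<close> be a finite dimensional semisimple subalgebra of \<open>R/J\<close>
  containing its image. The preimage of \<open>D\<close> is regular, so it has an idempotent \<open>e\<close> that lifts the
  identity of \<open>D\<close> and whose corner \<open>S\<close> contains \<open>F\<close>. Units of \<open>D\<close> lift to units of \<open>S\<close>: they are
  algebraic, so for a preimage \<open>x\<close> there is \<open>q\<close> commuting with \<open>x\<close> and \<open>e - xq \<in> J\<close>, and the obstruction
  to invertibility is confined to a corner in \<open>J\<close>. Hence, up to multiplication by units, an element of
  \<open>S\<close> is idempotent modulo \<open>J\<close>, and then it is the orthogonal sum of an idempotent and of an element of
  \<open>J\<close>. The latter has a unit inner inverse in a corner of \<open>J\<close>, as unit-regularity passes to corners.\<close>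

section \<open>Algebras and their embedding into a ring type\<close>

text \<open>The finite dimension of \<open>D\<close> is what makes units lift. In general they do
  not lift modulo a locally unit-regular ideal: in the algebra on \<open>x\<close>, \<open>y\<close>
  with the relation \<open>x y = 1\<close>, the ideal generated by \<open>1 - y x\<close> consists
  of the finite matrices, the quotient is the Laurent polynomial ring, and its variable has no
  invertible lift.

  The second obstacle is that unit inner inverses in two corners can be added only if the corners
  are orthogonal. An element that is idempotent modulo \<open>J\<close> splits into an idempotent
  and a remainder in \<open>J\<close>, but at first with an off-diagonal term between them. That
  term has square zero and is removed by a unit; the idempotent around the remainder is then sought
  in the annihilator of the other one.

  The second claim follows from the first, because the finite dimensional subalgebras of a locally
  f.d.ss algebra are themselves unit-regular.\<close>

definition diff :: "('k::field, 'a) alg \<Rightarrow> 'a \<Rightarrow> 'a \<Rightarrow> 'a" where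
  "diff A x y = add A x (smul A (- 1) y)"

locale algebra =
  fixes A :: "('k::field, 'a) alg"
  assumes algebra: "is_algebra A"
begin

abbreviation plus_A (infixl "\<oplus>" 65) where "x \<oplus> y \<equiv> add A x y"
abbreviation times_A (infixl "\<otimes>" 70) where "x \<otimes> y \<equiv> mul A x y"
abbreviation diff_A (infixl "\<ominus>" 65) where "x \<ominus> y \<equiv> diff A x y"
abbreviation zero_A ("\<zero>") where "\<zero> \<equiv> zero A"
abbreviation smul_A (infixr "\<cdot>" 75) where "c \<cdot> x \<equiv> smul A c x"
abbreviation carrier_A ("C") where "C \<equiv> carrier A"

lemma closed [simp]:
  "\<zero> \<in> C"
  "x \<in> C \<Longrightarrow> y \<in> C \<Longrightarrow> x \<oplus> y \<in> C"
  "x \<in> C \<Longrightarrow> y \<in> C \<Longrightarrow> x \<otimes> y \<in> C"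
  "x \<in> C \<Longrightarrow> c \<cdot> x \<in> C"
  "x \<in> C \<Longrightarrow> y \<in> C \<Longrightarrow> x \<ominus> y \<in> C"
  unfolding diff_def by (insert algebra [unfolded is_algebra_def], meson+)

lemma add_axioms:
  "x \<in> C \<Longrightarrow> y \<in> C \<Longrightarrow> z \<in> C \<Longrightarrow> x \<oplus> y \<oplus> z = x \<oplus> (y \<oplus> z)"
  "x \<in> C \<Longrightarrow> y \<in> C \<Longrightarrow> x \<oplus> y = y \<oplus> x"
  "x \<in> C \<Longrightarrow> \<zero> \<oplus> x = x"
  by (insert algebra [unfolded is_algebra_def], meson+)

lemma mul_axioms:
  "x \<in> C \<Longrightarrow> y \<in> C \<Longrightarrow> z \<in> C \<Longrightarrow> x \<otimes> y \<otimes> z = x \<otimes> (y \<otimes> z)"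
  "x \<in> C \<Longrightarrow> y \<in> C \<Longrightarrow> z \<in> C \<Longrightarrow> x \<otimes> (y \<oplus> z) = x \<otimes> y \<oplus> x \<otimes> z"
  "x \<in> C \<Longrightarrow> y \<in> C \<Longrightarrow> z \<in> C \<Longrightarrow> (x \<oplus> y) \<otimes> z = x \<otimes> z \<oplus> y \<otimes> z"
  by (insert algebra [unfolded is_algebra_def], meson+)

lemma smul_axioms:
  "x \<in> C \<Longrightarrow> y \<in> C \<Longrightarrow> c \<cdot> (x \<oplus> y) = c \<cdot> x \<oplus> c \<cdot> y"
  "x \<in> C \<Longrightarrow> (c + d) \<cdot> x = c \<cdot> x \<oplus> d \<cdot> x"
  "x \<in> C \<Longrightarrow> (c * d) \<cdot> x = c \<cdot> d \<cdot> x"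
  "x \<in> C \<Longrightarrow> 1 \<cdot> x = x"
  "x \<in> C \<Longrightarrow> y \<in> C \<Longrightarrow> c \<cdot> x \<otimes> y = c \<cdot> (x \<otimes> y)"
  "x \<in> C \<Longrightarrow> y \<in> C \<Longrightarrow> x \<otimes> c \<cdot> y = c \<cdot> (x \<otimes> y)"
  by (insert algebra [unfolded is_algebra_def], meson+)

text \<open>Cancellation in the form needed below: products with zero, in either kind of
  multiplication, are additive idempotents.\<close>

lemma idem_add_imp_zero:
  assumes "x \<in> C" "x \<oplus> x = x"
  shows "x = \<zero>"
proof -
  obtain y where "y \<in> C" "x \<oplus> y = \<zero>"
    using algebra assms(1) unfolding is_algebra_def by meson
  then show ?thesis
    by (metis add_axioms assms)
qed

lemma smul_zero [simp]: "x \<in> C \<Longrightarrow> 0 \<cdot> x = \<zero>" "c \<cdot> \<zero> = \<zero>"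
  by (metis add_0 closed(4) idem_add_imp_zero smul_axioms(2))
     (metis add_axioms(3) closed(1,4) idem_add_imp_zero smul_axioms(1))

lemma mul_zero [simp]: "x \<in> C \<Longrightarrow> \<zero> \<otimes> x = \<zero>" "x \<in> C \<Longrightarrow> x \<otimes> \<zero> = \<zero>"
  by (metis add_axioms(3) closed(1,3) idem_add_imp_zero mul_axioms(3))
     (metis add_axioms(3) closed(1,3) idem_add_imp_zero mul_axioms(2))

lemma diff_zero [simp]: "x \<in> C \<Longrightarrow> x \<ominus> \<zero> = x"
  by (metis add_axioms(2,3) closed(1) diff_def smul_zero(2))

lemma add_neg: "x \<in> C \<Longrightarrow> x \<oplus> (- 1) \<cdot> x = \<zero>"
  by (metis smul_axioms(2,4) smul_zero(1) add.right_inverse)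

end

text \<open>The product of all algebras on the type \<^typ>\<open>'a\<close>. It is a ring in the sense of the type class,
  and contains each of the algebras, so identities in a single algebra can be checked by
  type class reasoning.\<close>

typedef (overloaded) ('k::field, 'a) palg =
  "{F. \<forall>A :: ('k, 'a) alg. if is_algebra A then F A \<in> carrier A else F A = undefined}"
  by (rule exI[of _ "\<lambda>A. if is_algebra A then zero A else undefined"])
     (auto simp: is_algebra_def)

setup_lifting type_definition_palg

instantiation palg :: (field, type) ring
begin

lift_definition plus_palg :: "('a, 'b) palg \<Rightarrow> ('a, 'b) palg \<Rightarrow> ('a, 'b) palg" is
  "\<lambda>F G A. if is_algebra A then add A (F A) (G A) else undefined"
  by (auto simp: algebra.closed algebra_def split: if_splits)

lift_definition times_palg :: "('a, 'b) palg \<Rightarrow> ('a, 'b) palg \<Rightarrow> ('a, 'b) palg" is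
  "\<lambda>F G A. if is_algebra A then mul A (F A) (G A) else undefined"
  by (auto simp: algebra.closed algebra_def split: if_splits)

lift_definition minus_palg :: "('a, 'b) palg \<Rightarrow> ('a, 'b) palg \<Rightarrow> ('a, 'b) palg" is
  "\<lambda>F G A. if is_algebra A then diff A (F A) (G A) else undefined"
  by (auto simp: algebra.closed algebra_def split: if_splits)

lift_definition uminus_palg :: "('a, 'b) palg \<Rightarrow> ('a, 'b) palg" is
  "\<lambda>F A. if is_algebra A then smul A (- 1) (F A) else undefined"
  by (auto simp: algebra.closed algebra_def split: if_splits)

lift_definition zero_palg :: "('a, 'b) palg" is
  "\<lambda>A. if is_algebra A then zero A else undefined"
  by (auto simp: algebra.closed algebra_def split: if_splits)

instance
proof
  fix a b c :: "('a, 'b) palg"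
  show "a + b + c = a + (b + c)"
    by transfer (auto simp: algebra.add_axioms(1) algebra_def)
  show "a + b = b + a"
    by transfer (force simp: algebra.add_axioms(2) algebra_def)
  show "0 + a = a"
    by transfer (force simp: algebra.add_axioms(3) algebra_def)
  show "- a + a = 0"
    by transfer (force simp: algebra.add_axioms(2) algebra.add_neg algebra.closed algebra_def)
  show "a - b = a + - b"
    by transfer (auto simp: diff_def algebra_def)
  show "a * b * c = a * (b * c)"
    by transfer (auto simp: algebra.mul_axioms(1) algebra_def)
  show "(a + b) * c = a * c + b * c"
    by transfer (auto simp: algebra.mul_axioms(3) algebra_def)
  show "a * (b + c) = a * b + a * c"
    by transfer (auto simp: algebra.mul_axioms(2) algebra_def)
qed

end

text \<open>A type cannot depend on the algebra at hand, hence one type for all of them. Filling the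
  other components with zero is compatible with sums, differences and products alike.\<close>

lift_definition emb :: "('k::field, 'a) alg \<Rightarrow> 'a \<Rightarrow> ('k, 'a) palg" is
  "\<lambda>A x B. if is_algebra B then if A = B \<and> x \<in> carrier A then x else zero B else undefined"
  by (auto simp: algebra.closed algebra_def)

context algebra
begin

lemma emb:
  "emb A \<zero> = 0"
  "x \<in> C \<Longrightarrow> y \<in> C \<Longrightarrow> emb A (x \<oplus> y) = emb A x + emb A y"
  "x \<in> C \<Longrightarrow> y \<in> C \<Longrightarrow> emb A (x \<otimes> y) = emb A x * emb A y"
  "x \<in> C \<Longrightarrow> y \<in> C \<Longrightarrow> emb A (x \<ominus> y) = emb A x - emb A y"
  using algebra
  by (transfer; auto simp: fun_eq_iff add_axioms smul_axioms mul_axioms algebra.diff_zero algebra.mul_zero algebra.add_axioms algebra_def algebra.closed; fail)+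

lemma emb_eq_iff: "x \<in> C \<Longrightarrow> y \<in> C \<Longrightarrow> x = y \<longleftrightarrow> emb A x = emb A y"
  using algebra by (transfer) (auto simp: fun_eq_iff)

end

section \<open>Identities for idempotents and unit inner inverses\<close>

text \<open>Turns a relation between two factors into a rewrite rule that also applies at the head
  of a longer product bracketed to the right.\<close>

lemma mult_assoc_eq:
  fixes a :: "'a::semigroup_mult"
  assumes "a * b = c"
  shows "a * (b * x) = c * x"
  using assms by (simp flip: mult.assoc)

text \<open>Since \<open>e * h = 0\<close> is one-sided, \<open>e + h\<close> need not be
  idempotent. But \<open>h - h * e\<close> is an idempotent with the same right ideal as
  \<open>h\<close> and is orthogonal to \<open>e\<close> on both sides, so \<open>g\<close>
  generates the sum of the two right ideals.\<close>

lemma idempotent_join: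
  fixes e h :: "'a::ring"
  assumes "e * e = e" "h * h = h" "e * h = 0"
  defines "g \<equiv> e + h - h * e"
  shows "g * g = g" "g * e = e" "g * h = h" "e * g = e"
  using assms(1-3) assms(1-3) [THEN mult_assoc_eq]
  by (simp_all add: g_def algebra_simps)

text \<open>After adjoining a unit, \<open>1 - g = (1 - f) * (1 - e)\<close>; hence \<open>g\<close>
  inherits the left action of \<open>e\<close> and the right action of \<open>f\<close>.\<close>

lemma idempotent_two_sided:
  fixes e f :: "'a::ring"
  assumes "e * e = e" "f * f = f" "e * f = e"
  defines "g \<equiv> e + f - f * e"
  shows "g * g = g" "e * x = x \<Longrightarrow> g * x = x" "x * f = x \<Longrightarrow> x * g = x"
proof -
  note a = assms(1-3) assms(1-3) [THEN mult_assoc_eq]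
  show "g * g = g" "e * x = x \<Longrightarrow> g * x = x"
    using a by (simp_all add: g_def algebra_simps)
  show "x * f = x \<Longrightarrow> x * g = x"
    using mult_assoc_eq [of x f x] by (simp add: g_def algebra_simps)
qed

text \<open>The middle factor is \<open>y + (1 - y * x) * z * (1 - x * y)\<close>, expanded to avoid
  a unit. As \<open>x * (1 - y * x)\<close> and \<open>(1 - x * y) * x\<close> both equal
  \<open>r\<close>, the second summand contributes \<open>r * z * r = r\<close>, exactly the defect
  of \<open>y\<close>.\<close>

lemma regular_lift:
  fixes x y z :: "'a::ring"
  defines "r \<equiv> x - x * y * x"
  assumes "r * z * r = r"
  shows "x * (y + z - y * x * z - z * x * y + y * x * z * x * y) * x = x"
proof -
  have "x * (y + z - y * x * z - z * x * y + y * x * z * x * y) * x = x * y * x + r * z * r"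
    by (simp add: r_def algebra_simps)
  also have "\<dots> = x"
    by (simp add: assms(2)) (simp add: r_def)
  finally show ?thesis .
qed

text \<open>For an idempotent \<open>h\<close> in a ring with identity \<open>g\<close>, the elements \<open>y\<close> and \<open>b = y + (g - h)\<close> have the
  same kernel and cokernel, so an isomorphism between kernel and cokernel of \<open>b\<close>, encoded in a unit
  inner inverse \<open>w\<close>, yields a unit inner inverse of \<open>y\<close> in the corner of \<open>h\<close>.\<close>

lemma corner_unit_regular:
  fixes g h y w v :: "'a::ring"
  defines "b \<equiv> y + g - h"
  assumes h: "h * h = h" "g * h = h" "h * g = h" and y: "h * y = y" "y * h = y"
    and g: "g * g = g" "g * w = w" "w * g = w" "g * v = v" "v * g = v"
    and w: "w * v = g" "v * w = g" "b * w * b = b"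
  defines "p \<equiv> h * w * y * w * h + (w - w * b * w) * (h - y * w * h)"
    and "q \<equiv> y + (h - y * w * h) * v * (h - h * w * y)"
  shows "h * p = p" "p * h = p" "h * q = q" "q * h = q" "p * q = h" "q * p = h" "y * p * y = y"
proof -
  \<comment> \<open>A generalised inverse of \<open>y\<close> in the corner of \<open>h\<close>.
    Then \<open>P = h - r * y\<close> and \<open>Q = h - y * r\<close> are the projections onto the
    kernel of \<open>y\<close> and along its image.\<close>
  define r where "r = h * w * y * w * h"
  define P where "P = h - h * w * y"
  define Q where "Q = h - y * w * h"
  \<comment> \<open>Because \<open>b * c = 0\<close> and \<open>v * c = g - b * w\<close>, this part
    of \<open>w\<close> maps a complement of the image of \<open>b\<close> to the kernel of
    \<open>b\<close>, and \<open>v\<close> leads back.\<close>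
  define c where "c = w - w * b * w"
  define t where "t = c * Q"
  define s where "s = Q * v * P"
  \<comment> \<open>Padding \<open>r\<close> in the same way as \<open>b\<close> pads
    \<open>y\<close> shows that \<open>P\<close> and \<open>Q\<close> are also the defects of
    \<open>b\<close>: \<open>P = g - y' * b\<close> and \<open>Q = g - b * y'\<close>.\<close>
  define y' where "y' = r + g - h"
  have gy: "g * y = y" "y * g = y"
    by (metis h(2) mult.assoc y(1)) (metis h(3) mult.assoc y(2))
  have hb: "h * b = y" "b * h = y" "g * b = b" "b * g = b"
    unfolding b_def
    by (simp_all only: distrib_left distrib_right right_diff_distrib left_diff_distrib h y g gy) simp_all
  have ywy: "y * w * y = y"
  proof -
    have "h * (b * w * b) * h = y"
      unfolding w(3) by (simp only: hb y)
    then show ?thesis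
      using hb by (simp only: mult.assoc) (simp only: hb mult.assoc[symmetric])
  qed
  have ywy': "y * (w * y) = y" "\<And>z. y * (w * (y * z)) = y * z"
    using ywy by (simp_all flip: mult.assoc)
  note simps = algebra_simps h y g gy ywy' h[THEN mult_assoc_eq] y[THEN mult_assoc_eq]
    g[THEN mult_assoc_eq] gy[THEN mult_assoc_eq]
  have P: "P = g - y' * b" and Q: "Q = g - b * y'"
    by (simp_all add: P_def Q_def y'_def b_def r_def simps)
  have ry: "r * y = h * w * y" and yr: "y * r = y * w * h"
    and rQ: "r * Q = 0" and Pr: "P * r = 0" and Qy: "Q * y = 0"
    and hP: "h * P = P" "P * h = P" "h * Q = Q" "Q * h = Q" "g * P = P" "Q * g = Q" "Q * Q = Q"
    by (simp_all add: P_def Q_def r_def simps)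
  have bc: "b * c = 0"
    using w(3) by (simp add: c_def right_diff_distrib flip: mult.assoc)
  have bP: "b * P = 0" and Qb: "Q * b = 0"
    using hb ywy by (simp_all add: P_def Q_def right_diff_distrib left_diff_distrib mult_assoc_eq[OF hb(2)] mult.assoc)
  have Pc: "P * c = c"
    using bc by (simp add: P left_diff_distrib mult.assoc) (simp add: c_def algebra_simps g mult_assoc_eq[OF g(2)])
  have vc: "v * c = g - b * w"
    by (simp add: c_def algebra_simps mult_assoc_eq[OF w(2)] mult_assoc_eq[OF hb(3)] w(2) g)
  have cvb: "v * c * b = 0"
    using w(3) by (simp add: vc left_diff_distrib hb)
  have wvc: "w * (v * c) = c"
    by (simp flip: mult.assoc add: w(1)) (simp add: c_def algebra_simps g mult_assoc_eq[OF g(2)])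
  \<comment> \<open>The elements \<open>s\<close> and \<open>t\<close> turn out to be mutually
    inverse between the ranges of \<open>P\<close> and \<open>Q\<close>, which is just what
    completes \<open>y\<close> and \<open>r\<close> to the units \<open>q = y + s\<close> and
    \<open>p = r + t\<close> of the corner.\<close>
  have "s * t = Q * (v * (P * c)) * Q"
    by (simp add: s_def t_def mult.assoc)
  also have "\<dots> = Q"
    by (simp add: Pc vc algebra_simps hP mult_assoc_eq[OF Qb] mult_assoc_eq[OF hP(6)])
  finally have st: "s * t = Q" .
  have "v * c * Q = v * c"
    using cvb by (simp add: Q right_diff_distrib mult.assoc[symmetric]) (simp add: vc algebra_simps g)
  then have "c * Q = c"
    by (metis wvc mult.assoc)
  then have "t * s = c * v * P"
    by (simp add: t_def s_def flip: mult.assoc)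
  also have "\<dots> = P"
    by (simp add: c_def algebra_simps mult_assoc_eq[OF w(1)] hP bP w(1) hb)
  finally have ts: "t * s = P" .
  have yt: "y * t = 0"
    using bc by (metis hb(1) mult.assoc mult_zero_left mult_zero_right t_def)
  have p: "p = r + t" and q: "q = y + s"
    by (simp_all add: p_def q_def r_def t_def s_def c_def P_def Q_def)
  have hc: "h * c = c"
    by (metis Pc hP(1) mult.assoc)
  show "h * p = p" "p * h = p" "h * q = q" "q * h = q"
    using hc hP h y unfolding p q r_def t_def s_def
    by (simp_all add: algebra_simps) (simp_all flip: mult.assoc)
  show "p * q = h"
    using rQ Qy ts ry by (simp add: p q algebra_simps P_def) (simp add: t_def s_def mult.assoc mult_assoc_eq[OF rQ])
  show "q * p = h"
    using yt Pr st yr by (simp add: p q algebra_simps Q_def) (simp add: t_def s_def mult.assoc)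
  show "y * p * y = y"
    using yt ywy by (simp add: p distrib_left yr) (simp add: mult.assoc y)
qed

section \<open>Local identities in regular algebras\<close>

definition subspace :: "('k::field, 'a) alg \<Rightarrow> 'a set \<Rightarrow> bool" where
  "subspace A W \<longleftrightarrow> W \<subseteq> carrier A \<and> zero A \<in> W \<and>
     (\<forall>x\<in>W. \<forall>y\<in>W. add A x y \<in> W) \<and> (\<forall>c. \<forall>x\<in>W. smul A c x \<in> W)"

definition regular_set :: "('k::field, 'a) alg \<Rightarrow> 'a set \<Rightarrow> bool" where
  "regular_set A S \<longleftrightarrow> (\<forall>x\<in>S. \<exists>y\<in>S. mul A (mul A x y) x = x)"

lemma subspaceD:
  assumes "subspace A W"
  shows "x \<in> W \<Longrightarrow> x \<in> carrier A" "zero A \<in> W" "x \<in> W \<Longrightarrow> y \<in> W \<Longrightarrow> add A x y \<in> W"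
    "x \<in> W \<Longrightarrow> y \<in> W \<Longrightarrow> diff A x y \<in> W" "x \<in> W \<Longrightarrow> smul A c x \<in> W"
  using assms by (auto simp: subspace_def diff_def)

lemma subalgebraD:
  assumes "subalgebra A S"
  shows "x \<in> S \<Longrightarrow> x \<in> carrier A" "zero A \<in> S" "x \<in> S \<Longrightarrow> y \<in> S \<Longrightarrow> add A x y \<in> S"
    "x \<in> S \<Longrightarrow> y \<in> S \<Longrightarrow> diff A x y \<in> S" "x \<in> S \<Longrightarrow> smul A c x \<in> S"
    "x \<in> S \<Longrightarrow> y \<in> S \<Longrightarrow> mul A x y \<in> S"
  using assms by (auto simp: subalgebra_def diff_def)

abbreviation (in algebra) emb_A ("\<iota>") where "\<iota> \<equiv> emb A"

lemma (in algebra) subalgebra_is_algebra: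
  assumes "subalgebra A S"
  shows "is_algebra (A\<lparr>carrier := S\<rparr>)"
proof -
  note c = subalgebraD[OF assms]
  have "\<exists>y\<in>S. x \<oplus> y = \<zero>" if "x \<in> S" for x
    using c(5)[OF that, of "- 1"] add_neg[OF c(1)[OF that]] by blast
  then show ?thesis
    unfolding is_algebra_def
    by (intro conjI ballI allI) (simp_all add: c add_axioms(1,3) mul_axioms smul_axioms, simp add: c add_axioms(2))
qed

context algebra
begin

text \<open>One element is adjoined at a time: the part \<open>y\<close> of \<open>x\<close> that
  \<open>e\<close> misses satisfies \<open>e \<otimes> y = \<zero>\<close>, regularity gives an
  idempotent \<open>h = y \<otimes> z\<close> with the same right ideal as \<open>y\<close>, and
  \<open>idempotent_join\<close> merges it with \<open>e\<close>.\<close>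

lemma regular_left_identity:
  assumes S: "subalgebra A S" "regular_set A S" and "finite F" "F \<subseteq> S"
  shows "\<exists>e\<in>S. e \<otimes> e = e \<and> (\<forall>x\<in>F. e \<otimes> x = x)"
  using assms(3,4)
proof (induction F)
  case empty
  then show ?case
    using subalgebraD(2)[OF S(1)] by (auto intro!: bexI[of _ "\<zero>"])
next
  case (insert x F)
  note c = subalgebraD[OF S(1)]
  from insert obtain e where e: "e \<in> S" "e \<otimes> e = e" "\<forall>x\<in>F. e \<otimes> x = x"
    by auto
  have x: "x \<in> S"
    using insert by auto
  define y where "y = x \<ominus> e \<otimes> x"
  have y: "y \<in> S"
    using c e x by (simp add: y_def)
  then obtain z where z: "z \<in> S" "y \<otimes> z \<otimes> y = y"
    using S(2) by (auto simp: regular_set_def)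
  define h where "h = y \<otimes> z"
  have [simp]: "e \<in> C" "x \<in> C" "y \<in> C" "z \<in> C" "h \<in> C"
    using c x y z e by (auto simp: h_def)
  have ey: "e \<otimes> y = \<zero>"
    using e(2) mult_assoc_eq[of "emb A e" "emb A e" "emb A e"]
    by (simp add: y_def emb_eq_iff emb algebra_simps)
  have h: "h \<otimes> h = h" "e \<otimes> h = \<zero>" "h \<otimes> y = y"
    unfolding h_def using ey z(2) by (simp_all add: mul_axioms(1)[symmetric])
  define g where "g = e \<oplus> h \<ominus> h \<otimes> e"
  have "g \<in> S"
    unfolding g_def h_def by (intro c e y z)
  moreover have "\<iota> e * \<iota> e = \<iota> e" "\<iota> h * \<iota> h = \<iota> h" "\<iota> e * \<iota> h = 0"
    using e(2) h by (simp_all add: emb[symmetric])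
  from idempotent_join[OF this] have "g \<otimes> g = g" "g \<otimes> e = e" "g \<otimes> h = h"
    by (simp_all add: g_def emb_eq_iff emb)
  ultimately have g: "g \<in> S" "g \<otimes> g = g" "g \<otimes> e = e" "g \<otimes> h = h"
    by auto
  have gC [simp]: "g \<in> C"
    using c g by simp
  have ge: "g \<otimes> (e \<otimes> u) = e \<otimes> u" if "u \<in> C" for u
    using mul_axioms(1)[of g e u] g(3) that by simp
  have "g \<otimes> u = u" if "u \<in> F" for u
    using ge[of u] e(3) that insert.prems c(1) by auto
  moreover have "g \<otimes> x = x"
  proof -
    have "g \<otimes> y = y"
      using mul_axioms(1)[of g h y] g(4) h(3) by simp
    moreover have "y \<oplus> e \<otimes> x = x"
      by (simp add: y_def emb_eq_iff emb)
    ultimately show ?thesis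
      using ge[of x] mul_axioms(2)[of g y "e \<otimes> x"] by simp
  qed
  ultimately show ?case
    using g by auto
qed

lemma opposite: "algebra (A\<lparr>mul := \<lambda>x y. y \<otimes> x\<rparr>)"
proof -
  have "\<exists>y\<in>C. x \<oplus> y = \<zero>" if "x \<in> C" for x
    using closed(4)[OF that, of "- 1"] add_neg[OF that] by blast
  then show ?thesis
    unfolding algebra_def is_algebra_def
    by (intro conjI ballI allI) (simp_all add: add_axioms(1,3) mul_axioms smul_axioms, simp add: add_axioms(2))
qed

lemma regular_right_identity:
  assumes S: "subalgebra A S" "regular_set A S" and "finite F" "F \<subseteq> S"
  shows "\<exists>e\<in>S. e \<otimes> e = e \<and> (\<forall>x\<in>F. x \<otimes> e = x)"
proof -
  have "subalgebra (A\<lparr>mul := \<lambda>x y. y \<otimes> x\<rparr>) S"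
    using S(1) by (auto simp: subalgebra_def)
  moreover have "regular_set (A\<lparr>mul := \<lambda>x y. y \<otimes> x\<rparr>) S"
    using S mul_axioms(1) by (simp add: regular_set_def subalgebraD(1))
  ultimately show ?thesis
    using algebra.regular_left_identity[OF opposite _ _ assms(3,4)] by simp
qed

lemma regular_local_identity:
  assumes S: "subalgebra A S" "regular_set A S" and F: "finite F" "F \<subseteq> S"
  shows "\<exists>e\<in>S. e \<otimes> e = e \<and> (\<forall>x\<in>F. e \<otimes> x = x \<and> x \<otimes> e = x)"
proof -
  note c = subalgebraD[OF S(1)]
  obtain e where e: "e \<in> S" "e \<otimes> e = e" "\<And>x. x \<in> F \<Longrightarrow> e \<otimes> x = x"
    using regular_left_identity[OF S F] by auto
  \<comment> \<open>Letting \<open>f\<close> fix \<open>e\<close> as well provides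
    \<open>e \<otimes> f = e\<close>, without which the combination \<open>g\<close> below need not
    be idempotent.\<close>
  obtain f where f: "f \<in> S" "f \<otimes> f = f" "\<And>x. x \<in> insert e F \<Longrightarrow> x \<otimes> f = x"
    using regular_right_identity[OF S, of "insert e F"] F e(1) by auto
  have [simp]: "e \<in> C" "f \<in> C"
    using c e f by auto
  define g where "g = e \<oplus> f \<ominus> f \<otimes> e"
  have g: "g \<in> S"
    unfolding g_def by (intro c e f)
  have "\<iota> e * \<iota> e = \<iota> e" "\<iota> f * \<iota> f = \<iota> f" "\<iota> e * \<iota> f = \<iota> e"
    using e f by (simp_all add: emb[symmetric])
  note j = idempotent_two_sided[OF this]
  have "g \<otimes> g = g"
    using j(1) by (simp add: g_def emb_eq_iff emb)
  moreover have "g \<otimes> x = x \<and> x \<otimes> g = x" if x: "x \<in> F" for x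
  proof -
    have [simp]: "x \<in> C"
      using x F c by auto
    have "\<iota> e * \<iota> x = \<iota> x" "\<iota> x * \<iota> f = \<iota> x"
      using e(3)[OF x] f(3)[of x] x by (simp_all add: emb[symmetric])
    then show ?thesis
      using j(2,3)[of "\<iota> x"] by (simp add: g_def emb_eq_iff emb)
  qed
  ultimately show ?thesis
    using g by blast
qed

end

section \<open>Chain conditions in finite dimension\<close>

lemma lincomb_in_subspace:
  assumes "subspace A W" "set vs \<subseteq> W"
  shows "lincomb A (zip cs vs) \<in> W"
  using assms(2)
proof (induction vs arbitrary: cs)
  case (Cons v vs)
  then show ?case
    using subspaceD[OF assms(1)] by (cases cs) auto
qed (use assms in \<open>auto simp: subspace_def\<close>)

context algebra
begin

lemma smul_diff: "x \<in> C \<Longrightarrow> (a - b) \<cdot> x = a \<cdot> x \<ominus> b \<cdot> x"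
  using smul_axioms(2)[of x a "- b"] smul_axioms(3)[of x "- 1" b] by (simp add: diff_def)

lemma lincomb_closed: "set vs \<subseteq> C \<Longrightarrow> lincomb A (zip cs vs) \<in> C"
  using lincomb_in_subspace[of A C] by (simp add: subspace_def)

lemma lincomb_diff:
  assumes "length as = length vs" "length bs = length vs" "set vs \<subseteq> C"
  shows "lincomb A (zip as vs) \<ominus> c \<cdot> lincomb A (zip bs vs) =
    lincomb A (zip (map2 (\<lambda>a b. a - c * b) as bs) vs)"
proof -
  have "length as = length bs" "length bs = length vs"
    using assms by auto
  then show ?thesis
    using assms(3)
  proof (induction as bs vs rule: list_induct3)
    case (Cons a as b bs v vs)
    define s t where "s = lincomb A (zip as vs)" and "t = lincomb A (zip bs vs)"
    have [simp]: "v \<in> C" "s \<in> C" "t \<in> C"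
      using Cons lincomb_closed by (auto simp: s_def t_def)
    have "(a \<cdot> v \<oplus> s) \<ominus> c \<cdot> (b \<cdot> v \<oplus> t) = (a - c * b) \<cdot> v \<oplus> (s \<ominus> c \<cdot> t)"
      by (simp add: smul_diff smul_axioms emb_eq_iff emb)
    then show ?case
      using Cons by (simp add: s_def t_def)
  qed simp_all
qed

text \<open>A finite dimensional space has a chain of subspaces \<open>V i\<close>, ascending from \<open>0\<close> to the whole space,
  each of codimension at most one in the next. A subspace \<open>W\<close> is measured by the number of indices at
  which it has an element of \<open>V (Suc i)\<close> outside \<open>V i\<close>.\<close>

lemma fin_dim_flag:
  assumes "fin_dim A"
  obtains V and n :: nat where "\<And>x. x \<in> V 0 \<Longrightarrow> x = \<zero>" "\<And>x. x \<in> C \<Longrightarrow> x \<in> V n"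
    "\<And>i x y. x \<in> V (Suc i) \<Longrightarrow> y \<in> V (Suc i) \<Longrightarrow> y \<notin> V i \<Longrightarrow> \<exists>c. x \<ominus> c \<cdot> y \<in> V i"
proof -
  obtain vs where vs: "set vs \<subseteq> C"
    and span: "\<And>x. x \<in> C \<Longrightarrow> \<exists>cs. length cs = length vs \<and> x = lincomb A (zip cs vs)"
    using assms unfolding fin_dim_def by blast
  define n where "n = length vs"
  \<comment> \<open>\<open>V i\<close> is spanned by the last \<open>i\<close> vectors of the list;
    \<open>min i n\<close> keeps it constant beyond the length. The list only spans, so consecutive
    members may coincide.\<close>
  define V where "V i = {lincomb A (zip cs (drop (n - i) vs)) | cs. length cs = min i n}" for i
  have "x = \<zero>" if "x \<in> V 0" for x
    using that by (auto simp: V_def)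
  moreover have "x \<in> V n" if "x \<in> C" for x
    using span[OF that] by (auto simp: V_def n_def)
  moreover have "\<exists>c. x \<ominus> c \<cdot> y \<in> V i"
    if x: "x \<in> V (Suc i)" and y: "y \<in> V (Suc i)" "y \<notin> V i" for x y i
  proof (cases "i < n")
    case False
    then show ?thesis
      using y by (simp add: V_def)
  next
    case True
    define v ws where "v = vs ! (n - Suc i)" and "ws = drop (n - i) vs"
    have *: "drop (n - Suc i) vs = v # ws"
      using True unfolding v_def ws_def n_def
      by (metis Cons_nth_drop_Suc Suc_diff_Suc diff_less length_greater_0_conv list.size(3) not_less_zero zero_less_Suc)
    have v: "v \<in> C" "set ws \<subseteq> C" "length ws = i"
      using True vs by (auto simp: v_def ws_def n_def dest: in_set_dropD)
    obtain a as where x: "x = a \<cdot> v \<oplus> lincomb A (zip as ws)" "length as = i"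
      using x True * by (auto simp: V_def length_Suc_conv)
    obtain b bs where y': "y = b \<cdot> v \<oplus> lincomb A (zip bs ws)" "length bs = i"
      using y(1) True * by (auto simp: V_def length_Suc_conv)
    have l: "lincomb A (zip cs ws) \<in> C" for cs
      using lincomb_closed v by simp
    have "b \<noteq> 0"
    proof
      assume "b = 0"
      with y' v l have "y = lincomb A (zip bs ws)"
        by (simp add: add_axioms)
      then show False
        using y y' True by (auto simp: V_def ws_def)
    qed
    have "x \<ominus> (a / b) \<cdot> y = lincomb A (zip as ws) \<ominus> (a / b) \<cdot> lincomb A (zip bs ws)"
      using \<open>b \<noteq> 0\<close> v l unfolding x y'
      by (simp add: smul_axioms(1) smul_axioms(3)[symmetric]) (simp add: emb_eq_iff emb)
    also have "\<dots> = lincomb A (zip (map2 (\<lambda>s t. s - a / b * t) as bs) ws)"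
      using lincomb_diff x y' v by simp
    also have "\<dots> \<in> V i"
      using True x y' by (auto simp: V_def ws_def intro!: exI[of _ "map2 (\<lambda>s t. s - a / b * t) as bs"])
    finally show ?thesis by blast
  qed
  ultimately show thesis
    using that by blast
qed

text \<open>A substitute for the dimension. If nested subspaces have the same pivots, an element of
  the larger one is reduced down the flag by elements of the smaller one, as in Gaussian
  elimination, and so lies in the smaller one.\<close>

lemma fin_dim_measure:
  assumes "fin_dim A"
  obtains \<mu> :: "'a set \<Rightarrow> nat" and n
  where "\<And>W. \<mu> W \<le> n" "\<And>W W'. subspace A W \<Longrightarrow> subspace A W' \<Longrightarrow> W \<subset> W' \<Longrightarrow> \<mu> W < \<mu> W'"
proof -
  obtain V n where V: "\<And>x. x \<in> V 0 \<Longrightarrow> x = \<zero>" "\<And>x. x \<in> C \<Longrightarrow> x \<in> V n"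
    "\<And>i x y. x \<in> V (Suc i) \<Longrightarrow> y \<in> V (Suc i) \<Longrightarrow> y \<notin> V i \<Longrightarrow> \<exists>c. x \<ominus> c \<cdot> y \<in> V i"
    using fin_dim_flag[OF assms] by metis
  define piv where "piv W = {i. i < n \<and> (\<exists>w\<in>W. w \<in> V (Suc i) \<and> w \<notin> V i)}" for W
  have fin: "finite (piv W)" for W
    by (rule finite_subset[of _ "{..<n}"]) (auto simp: piv_def)
  have "card (piv W) \<le> n" for W
    using card_mono[of "{..<n}" "piv W"] by (auto simp: piv_def)
  moreover have "card (piv W) < card (piv W')" if W: "subspace A W" "subspace A W'" "W \<subset> W'" for W W'
  proof (rule psubset_card_mono[OF fin], rule psubsetI)
    show "piv W \<subseteq> piv W'"
      using W(3) by (auto simp: piv_def)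
    show "piv W \<noteq> piv W'"
    proof
      assume eq: "piv W = piv W'"
      have "w \<in> W" if "w \<in> W'" "w \<in> V i" "i \<le> n" for i w
        using that
      proof (induction i arbitrary: w)
        case 0
        then show ?case
          using V(1) subspaceD(2)[OF W(1)] by auto
      next
        case (Suc i)
        show ?case
        proof (cases "w \<in> V i")
          case False
          then have "i \<in> piv W"
            using Suc.prems eq by (auto simp: piv_def)
          then obtain u where u: "u \<in> W" "u \<in> V (Suc i)" "u \<notin> V i"
            by (auto simp: piv_def)
          then obtain c where c: "w \<ominus> c \<cdot> u \<in> V i"
            using V(3) Suc.prems by blast
          have cu: "c \<cdot> u \<in> W"
            using u subspaceD[OF W(1)] by auto
          then have "w \<ominus> c \<cdot> u \<in> W'"
            using W Suc.prems subspaceD[OF W(2)] by blast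
          then have "w \<ominus> c \<cdot> u \<in> W"
            using Suc c by simp
          then have "(w \<ominus> c \<cdot> u) \<oplus> c \<cdot> u \<in> W"
            using cu subspaceD[OF W(1)] by blast
          moreover have "(w \<ominus> c \<cdot> u) \<oplus> c \<cdot> u = w"
            using Suc.prems cu subspaceD(1)[OF W(2)] subspaceD(1)[OF W(1)]
            by (simp add: emb_eq_iff emb)
          ultimately show ?thesis by simp
        qed (use Suc in auto)
      qed
      then have "W' \<subseteq> W"
        using V(2) subspaceD(1)[OF W(2)] by blast
      then show False
        using W by blast
    qed
  qed
  ultimately show thesis
    using that[of "\<lambda>W. card (piv W)" n] by blast
qed

end

section \<open>Right ideals and extremal choices in finite dimension\<close>

definition right_ideal :: "('k::field, 'a) alg \<Rightarrow> 'a set \<Rightarrow> bool" where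
  "right_ideal A W \<longleftrightarrow> subspace A W \<and> (\<forall>x\<in>W. \<forall>a\<in>carrier A. mul A x a \<in> W)"

context algebra
begin

text \<open>The family is indexed because the index is what applications want: an idempotent, an
  inner inverse or an exponent whose attached subspace is smallest.\<close>

lemma fin_dim_minimal:
  assumes "fin_dim A" "P k" "\<And>k. P k \<Longrightarrow> subspace A (W k)"
  obtains k where "P k" "\<And>l. P l \<Longrightarrow> \<not> W l \<subset> W k"
proof -
  obtain \<mu> :: "'a set \<Rightarrow> nat"
    where \<mu>: "\<And>W W'. subspace A W \<Longrightarrow> subspace A W' \<Longrightarrow> W \<subset> W' \<Longrightarrow> \<mu> W < \<mu> W'"
    using fin_dim_measure[OF assms(1)] by metis
  obtain k where "P k" "\<And>l. P l \<Longrightarrow> \<mu> (W k) \<le> \<mu> (W l)"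
    using ex_has_least_nat[of P k "\<lambda>k. \<mu> (W k)"] assms(2) by blast
  then show thesis
    using that \<mu> assms(3) by (meson leD)
qed

lemma fin_dim_maximal:
  assumes "fin_dim A" "P k" "\<And>k. P k \<Longrightarrow> subspace A (W k)"
  obtains k where "P k" "\<And>l. P l \<Longrightarrow> \<not> W k \<subset> W l"
proof -
  obtain \<mu> :: "'a set \<Rightarrow> nat" and n
    where \<mu>: "\<And>W W'. subspace A W \<Longrightarrow> subspace A W' \<Longrightarrow> W \<subset> W' \<Longrightarrow> \<mu> W < \<mu> W'" "\<And>W. \<mu> W \<le> n"
    using fin_dim_measure[OF assms(1)] by metis
  obtain k where "P k" "\<And>l. P l \<Longrightarrow> \<mu> (W l) \<le> \<mu> (W k)"
    using ex_has_greatest_nat[of P k "\<lambda>k. \<mu> (W k)" "Suc n"] assms(2) \<mu>(2)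
    by (metis less_Suc_eq_le)
  then show thesis
    using that \<mu> assms(3) by (meson leD)
qed

lemma subspace_kernel:
  assumes "subspace A V" "u \<in> C"
  shows "subspace A {y\<in>V. u \<otimes> y = \<zero>}"
  using subspaceD[OF assms(1)] assms(2) add_axioms(3)[of \<zero>]
  by (auto simp: subspace_def mul_axioms smul_axioms)

lemma subspace_image:
  assumes V: "subspace A V" and u: "u \<in> C"
  shows "subspace A ((\<otimes>) u ` V)"
  unfolding subspace_def
proof (intro conjI ballI allI)
  show "(\<otimes>) u ` V \<subseteq> C"
    using subspaceD[OF V] u by auto
  show "\<zero> \<in> (\<otimes>) u ` V"
    using subspaceD(2)[OF V] u by (metis imageI mul_zero(2))
  fix x c
  assume "x \<in> (\<otimes>) u ` V"
  then obtain v where v: "v \<in> V" "x = u \<otimes> v" by auto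
  show "c \<cdot> x \<in> (\<otimes>) u ` V"
    using v u subspaceD[OF V] smul_axioms(6)[of u v c, symmetric] by simp
  fix y
  assume "y \<in> (\<otimes>) u ` V"
  then obtain w where w: "w \<in> V" "y = u \<otimes> w" by auto
  show "x \<oplus> y \<in> (\<otimes>) u ` V"
    using v w u subspaceD[OF V] mul_axioms(2)[of u v w, symmetric] by simp
qed

lemma right_idealD:
  assumes "right_ideal A W"
  shows "subspace A W" "x \<in> W \<Longrightarrow> a \<in> C \<Longrightarrow> x \<otimes> a \<in> W"
  using assms by (auto simp: right_ideal_def)

lemma right_ideal_kernel:
  assumes W: "right_ideal A W" and u: "u \<in> C"
  shows "right_ideal A {y\<in>W. u \<otimes> y = \<zero>}"
  using subspace_kernel[OF right_idealD(1)[OF W] u] right_idealD(2)[OF W]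
    subspaceD(1)[OF right_idealD(1)[OF W]] u
  by (auto simp: right_ideal_def mul_axioms(1)[symmetric])

lemma right_ideal_image:
  assumes W: "right_ideal A W" and u: "u \<in> C"
  shows "right_ideal A ((\<otimes>) u ` W)"
  using subspace_image[OF right_idealD(1)[OF W] u] right_idealD(2)[OF W]
    subspaceD(1)[OF right_idealD(1)[OF W]] u
  by (auto simp: right_ideal_def mul_axioms(1))

lemma diff_eq_zero_iff: "x \<in> C \<Longrightarrow> y \<in> C \<Longrightarrow> x \<ominus> y = \<zero> \<longleftrightarrow> x = y"
  by (simp add: emb_eq_iff emb)

lemma mul_diff:
  "x \<in> C \<Longrightarrow> y \<in> C \<Longrightarrow> z \<in> C \<Longrightarrow> x \<otimes> (y \<ominus> z) = x \<otimes> y \<ominus> x \<otimes> z"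
  "x \<in> C \<Longrightarrow> y \<in> C \<Longrightarrow> z \<in> C \<Longrightarrow> (x \<ominus> y) \<otimes> z = x \<otimes> z \<ominus> y \<otimes> z"
  by (simp_all add: emb_eq_iff emb algebra_simps)

lemma funpow_mul_subspace:
  assumes "subspace A V" "u \<in> C"
  shows "subspace A (((\<otimes>) u ^^ n) ` V)"
proof (induction n)
  case (Suc n)
  then show ?case
    using subspace_image[OF Suc assms(2)] by (simp add: image_comp)
qed (use assms in simp)

text \<open>The images of the powers of \<open>u\<close> on \<open>V\<close> decrease and hence
  stabilise, so the \<open>n\<close>-th power takes the same value at \<open>v\<close> and at some
  \<open>u \<otimes> w\<close>; injectivity cancels it.\<close>

lemma inj_imp_surj:
  assumes fd: "fin_dim A" and V: "subspace A V" and u: "u \<in> C" "\<And>v. v \<in> V \<Longrightarrow> u \<otimes> v \<in> V"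
    and inj: "\<And>v. v \<in> V \<Longrightarrow> u \<otimes> v = \<zero> \<Longrightarrow> v = \<zero>" and v: "v \<in> V"
  shows "\<exists>w\<in>V. u \<otimes> w = v"
proof -
  define f where "f = (\<otimes>) u"
  have VC: "x \<in> C" if "x \<in> V" for x
    using subspaceD(1)[OF V that] .
  have pow: "(f ^^ n) x \<in> V" if "x \<in> V" for n x
    using that u by (induction n) (auto simp: f_def)
  have "x = y" if "x \<in> V" "y \<in> V" "f x = f y" for x y
    using inj[of "x \<ominus> y"] that VC u subspaceD(4)[OF V] by (simp add: f_def mul_diff diff_eq_zero_iff)
  then have injf: "x = y" if "x \<in> V" "y \<in> V" "(f ^^ n) x = (f ^^ n) y" for x y n
    using that by (induction n) (auto simp: pow)
  obtain n where n: "\<And>m. \<not> (f ^^ m) ` V \<subset> (f ^^ n) ` V"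
    using fin_dim_minimal[of "\<lambda>_. True" 0 "\<lambda>n. (f ^^ n) ` V"] fd funpow_mul_subspace[OF V u(1)]
    by (auto simp: f_def)
  have "(f ^^ Suc n) ` V \<subseteq> (f ^^ n) ` V"
    using u by (auto simp: f_def funpow_swap1)
  with n have "(f ^^ n) v \<in> (f ^^ Suc n) ` V"
    using v by blast
  then obtain w where w: "w \<in> V" "(f ^^ n) v = (f ^^ n) (f w)"
    by (auto simp: funpow_swap1)
  then have "v = f w"
    using injf[of v "f w" n] v u by (simp add: f_def)
  then show ?thesis
    using w by (auto simp: f_def)
qed

section \<open>Finite dimensional semisimple algebras are regular and unital\<close>

inductive_set sandwich_ideal :: "'a \<Rightarrow> 'a set" for x where
  zero: "\<zero> \<in> sandwich_ideal x"
| step: "a \<in> C \<Longrightarrow> b \<in> C \<Longrightarrow> y \<in> sandwich_ideal x \<Longrightarrow> a \<otimes> x \<otimes> b \<oplus> y \<in> sandwich_ideal x"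

context
  assumes ss: "fd_semisimple A"
begin

lemma semisimple_fin_dim: "fin_dim A"
  using ss by (simp add: fd_semisimple_def)

lemma square_zero_ideal:
  assumes "alg_ideal A I" "\<And>x y. x \<in> I \<Longrightarrow> y \<in> I \<Longrightarrow> x \<otimes> y = \<zero>"
  shows "I = {\<zero>}"
proof -
  have "mprod A xs = \<zero>" if "length xs = 2" "set xs \<subseteq> I" for xs
    using that assms(2) by (auto simp: length_Suc_conv numeral_2_eq_2)
  then have "nilpotent_ideal A I"
    unfolding nilpotent_ideal_def using assms(1) by (metis one_le_numeral)
  then show ?thesis
    using ss by (simp add: fd_semisimple_def)
qed

text \<open>The elements that kill everything on their right form an ideal of square zero.\<close>

lemma left_annihilator_zero:
  assumes "x \<in> C" "\<And>y. y \<in> C \<Longrightarrow> x \<otimes> y = \<zero>"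
  shows "x = \<zero>"
proof -
  have "{x\<in>C. \<forall>y\<in>C. x \<otimes> y = \<zero>} = {\<zero>}"
    by (rule square_zero_ideal) (auto simp: alg_ideal_def mul_axioms smul_axioms add_axioms(3))
  then show ?thesis
    using assms by blast
qed

lemma right_annihilator_zero:
  assumes "x \<in> C" "\<And>y. y \<in> C \<Longrightarrow> y \<otimes> x = \<zero>"
  shows "x = \<zero>"
proof -
  have "{x\<in>C. \<forall>y\<in>C. y \<otimes> x = \<zero>} = {\<zero>}"
    by (rule square_zero_ideal)
       (auto simp: alg_ideal_def mul_axioms(2,3) mul_axioms(1)[symmetric] smul_axioms add_axioms(3))
  then show ?thesis
    using assms by blast
qed

text \<open>The hypothesis makes the ideal of sums of elements
  \<open>a \<otimes> x \<otimes> b\<close> square to zero, so it vanishes. As no identity is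
  available yet, this ideal is not known to contain \<open>x\<close>; the two annihilator lemmas
  strip the outer factors one after the other.\<close>

lemma semiprime:
  assumes x: "x \<in> C" and sq: "\<And>a. a \<in> C \<Longrightarrow> x \<otimes> a \<otimes> x = \<zero>"
  shows "x = \<zero>"
proof -
  define I where "I = sandwich_ideal x"
  have IC: "y \<in> C" if "y \<in> I" for y
    using that unfolding I_def by induction (use x in auto)
  have add: "y \<oplus> z \<in> I" if "y \<in> I" "z \<in> I" for y z
    using that(1) unfolding I_def
  proof induction
    case zero
    then show ?case using that(2) IC by (simp add: add_axioms(3) I_def)
  next
    case (step a b y)
    then show ?case
      using IC[unfolded I_def] that(2) x sandwich_ideal.step[of a b "y \<oplus> z" x] by (simp add: add_axioms(1) I_def)
  qed
  have smul: "c \<cdot> y \<in> I" if "y \<in> I" for y c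
    using that unfolding I_def
  proof induction
    case zero
    then show ?case by (simp add: sandwich_ideal.zero)
  next
    case (step a b y)
    then show ?case
      using IC[unfolded I_def] x sandwich_ideal.step[of "c \<cdot> a" b "c \<cdot> y" x] by (simp add: smul_axioms)
  qed
  have mul: "r \<otimes> y \<in> I \<and> y \<otimes> r \<in> I" if "y \<in> I" "r \<in> C" for y r
    using that(1) unfolding I_def
  proof induction
    case zero
    then show ?case using that(2) by (simp add: sandwich_ideal.zero)
  next
    case (step a b y)
    then show ?case
      using IC[unfolded I_def] x that(2) sandwich_ideal.step[of "r \<otimes> a" b "r \<otimes> y" x]
        sandwich_ideal.step[of a "b \<otimes> r" "y \<otimes> r" x] by (simp add: mul_axioms)
  qed
  have sand: "a \<otimes> x \<otimes> b \<otimes> z = \<zero>" if "a \<in> C" "b \<in> C" "z \<in> I" for a b z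
    using that(3) unfolding I_def
  proof induction
    case zero
    then show ?case using that x by simp
  next
    case (step c d z)
    have "a \<otimes> x \<otimes> b \<otimes> (c \<otimes> x \<otimes> d) = a \<otimes> (x \<otimes> (b \<otimes> c) \<otimes> x) \<otimes> d"
      using that x step by (simp add: mul_axioms(1))
    also have "\<dots> = \<zero>"
      using that x step sq by simp
    finally show ?case
      using that x step IC[unfolded I_def] by (simp add: mul_axioms(2) add_axioms(3))
  qed
  have "y \<otimes> z = \<zero>" if "y \<in> I" "z \<in> I" for y z
    using that(1) unfolding I_def
  proof induction
    case (step a b y)
    then show ?case using that x IC IC[unfolded I_def] sand by (simp add: mul_axioms(3) add_axioms(3))
  qed (use that IC in simp)
  moreover have "alg_ideal A I"
    unfolding alg_ideal_def using IC add smul mul sandwich_ideal.zero by (auto simp: I_def)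
  ultimately have I: "I = {\<zero>}"
    by (intro square_zero_ideal)
  have "a \<otimes> x \<otimes> b = \<zero>" if "a \<in> C" "b \<in> C" for a b
    using sandwich_ideal.step[OF that sandwich_ideal.zero, of x] that x I
    by (simp add: I_def add_axioms(2)[of _ \<zero>] add_axioms(3))
  then have "a \<otimes> x = \<zero>" if "a \<in> C" for a
    using that x left_annihilator_zero by simp
  then show ?thesis
    using x right_annihilator_zero by simp
qed

end

text \<open>Brauer's lemma. In a minimal right ideal \<open>M\<close>, an element \<open>m\<close>
  with \<open>m \<otimes> x \<noteq> \<zero>\<close> for some \<open>x\<close> in \<open>M\<close>
  acts on \<open>M\<close> bijectively. Solving \<open>m \<otimes> e = m\<close> in \<open>M\<close>
  gives the idempotent, since \<open>e \<otimes> e \<ominus> e\<close> lies in the kernel.\<close>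

lemma right_ideal_has_idempotent:
  assumes ss: "fd_semisimple A" and W: "right_ideal A W" "W \<noteq> {\<zero>}"
  obtains e where "e \<in> W" "e \<otimes> e = e" "e \<noteq> \<zero>"
proof -
  define P where "P M \<longleftrightarrow> right_ideal A M \<and> M \<subseteq> W \<and> M \<noteq> {\<zero>}" for M
  obtain M where M: "P M" "\<And>N. P N \<Longrightarrow> \<not> N \<subset> M"
    using fin_dim_minimal[OF semisimple_fin_dim[OF ss], of P W "\<lambda>M. M"] W by (auto simp: P_def right_ideal_def)
  have r: "right_ideal A M" "M \<subseteq> W" "M \<noteq> {\<zero>}"
    using M(1) by (auto simp: P_def)
  note c = subspaceD[OF right_idealD(1)[OF r(1)]]
  obtain x where x: "x \<in> M" "x \<noteq> \<zero>"
    using c(2) r(3) by blast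
  obtain a where a: "a \<in> C" "x \<otimes> a \<otimes> x \<noteq> \<zero>"
    using semiprime[OF ss c(1)[OF x(1)]] x by blast
  define m where "m = x \<otimes> a"
  have m: "m \<in> M" "m \<in> C" "m \<otimes> x \<noteq> \<zero>"
    using right_idealD(2)[OF r(1) x(1) a(1)] c(1) a(2) by (auto simp: m_def)
  have "(\<otimes>) m ` M \<subseteq> M"
    using right_idealD(2)[OF r(1) m(1)] c(1) by auto
  moreover have "P ((\<otimes>) m ` M)"
    using right_ideal_image[OF r(1) m(2)] calculation r(2) m(3) x(1) by (auto simp: P_def)
  ultimately have "(\<otimes>) m ` M = M"
    using M(2) by blast
  then obtain e where e: "e \<in> M" "m \<otimes> e = m"
    using m(1) by (metis imageE)
  have eC: "e \<in> C"
    using c(1) e by simp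
  define N where "N = {y\<in>M. m \<otimes> y = \<zero>}"
  have "N \<subset> M"
    using m(3) x(1) by (auto simp: N_def)
  moreover have "right_ideal A N"
    using right_ideal_kernel[OF r(1) m(2)] by (simp add: N_def)
  ultimately have "N = {\<zero>}"
    using M(2)[of N] r(2) by (auto simp: P_def)
  moreover have "e \<otimes> e \<ominus> e \<in> N"
    using e eC m right_idealD(2)[OF r(1) e(1) eC] c(4)
    by (simp add: N_def mul_diff mul_axioms(1)[symmetric] diff_eq_zero_iff)
  ultimately have "e \<otimes> e = e"
    using eC diff_eq_zero_iff[of "e \<otimes> e" e] by simp
  moreover have "e \<noteq> \<zero>"
    using e m c(1)[OF x(1)] by auto
  ultimately show thesis
    using that e(1) r(2) by blast
qed

text \<open>For an idempotent \<open>e\<close> in \<open>W\<close> the set \<open>V e\<close> is the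
  part of \<open>W\<close> not yet covered. Were it nonzero at its smallest, it would contain an
  idempotent, and joining that one to \<open>e\<close> would shrink it further.\<close>

lemma right_ideal_generated_by_idempotent:
  assumes ss: "fd_semisimple A" and W: "right_ideal A W"
  obtains e where "e \<in> W" "e \<otimes> e = e" "\<And>x. x \<in> W \<Longrightarrow> e \<otimes> x = x"
proof -
  note c = subspaceD[OF right_idealD(1)[OF W]]
  define V where "V e = {x\<in>W. e \<otimes> x = \<zero>}" for e
  have V: "right_ideal A (V e)" if "e \<in> W" for e
    using right_ideal_kernel[OF W] c(1)[OF that] by (simp add: V_def)
  define P where "P e \<longleftrightarrow> e \<in> W \<and> e \<otimes> e = e" for e
  have "P \<zero>" "\<And>e. P e \<Longrightarrow> subspace A (V e)"
    using c(2) right_idealD(1)[OF V] by (auto simp: P_def)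
  then obtain e where e: "P e" and min: "\<And>f. P f \<Longrightarrow> \<not> V f \<subset> V e"
    using fin_dim_minimal[OF semisimple_fin_dim[OF ss], of P \<zero> V] by blast
  then have e: "e \<in> W" "e \<otimes> e = e"
    by (auto simp: P_def)
  have [simp]: "e \<in> C"
    using c(1) e by simp
  have "V e = {\<zero>}"
  proof (rule ccontr)
    assume "V e \<noteq> {\<zero>}"
    then obtain f where f: "f \<in> V e" "f \<otimes> f = f" "f \<noteq> \<zero>"
      using right_ideal_has_idempotent[OF ss V[OF e(1)]] by blast
    then have f': "f \<in> W" "e \<otimes> f = \<zero>"
      by (auto simp: V_def)
    have [simp]: "f \<in> C"
      using c(1) f' by simp
    define g where "g = e \<oplus> f \<ominus> f \<otimes> e"
    have g: "g \<in> W"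
      unfolding g_def by (intro c e f' right_idealD(2)[OF W] \<open>e \<in> C\<close>)
    have [simp]: "g \<in> C"
      using c(1) g by simp
    have "\<iota> e * \<iota> e = \<iota> e" "\<iota> f * \<iota> f = \<iota> f" "\<iota> e * \<iota> f = 0"
      using e f f' by (simp_all add: emb[symmetric])
    from idempotent_join[OF this] have gg: "g \<otimes> g = g" "g \<otimes> f = f" "e \<otimes> g = e"
      by (simp_all add: g_def emb_eq_iff emb)
    have "x \<in> V e" if "x \<in> V g" for x
    proof -
      have "e \<otimes> x = e \<otimes> (g \<otimes> x)"
        using gg(3) that c(1) mul_axioms(1)[of e g x] by (simp add: V_def)
      then show ?thesis
        using that by (simp add: V_def)
    qed
    moreover have "f \<notin> V g"
      using gg f by (simp add: V_def)
    ultimately have "V g \<subset> V e"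
      using f(1) by blast
    then show False
      using min g gg by (auto simp: P_def)
  qed
  moreover have "x \<ominus> e \<otimes> x \<in> V e" if "x \<in> W" for x
    using that c e right_idealD(2)[OF W e(1)]
    by (simp add: V_def mul_diff mul_axioms(1)[symmetric] diff_eq_zero_iff)
  ultimately have "e \<otimes> x = x" if "x \<in> W" for x
    using that c(1) diff_eq_zero_iff[of x "e \<otimes> x"] by fastforce
  then show thesis
    using that e by blast
qed

lemma semisimple_regular:
  assumes ss: "fd_semisimple A"
  shows "regular_set A C"
  unfolding regular_set_def
proof
  fix x
  assume x [simp]: "x \<in> C"
  \<comment> \<open>The scalar multiples are included so that \<open>W\<close> contains
    \<open>x\<close>: without an identity, \<open>x\<close> is not known to be of the form
    \<open>x \<otimes> a\<close>.\<close>
  define W where "W = {c \<cdot> x \<oplus> x \<otimes> a | c a. a \<in> C}"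
  have "right_ideal A W"
    unfolding right_ideal_def subspace_def
  proof (intro conjI ballI allI)
    show "W \<subseteq> C"
      by (auto simp: W_def)
    show "\<zero> \<in> W"
      unfolding W_def by (intro CollectI exI[of _ 0] exI[of _ \<zero>]) (simp add: add_axioms)
    fix y assume "y \<in> W"
    then obtain c a where y: "y = c \<cdot> x \<oplus> x \<otimes> a" "a \<in> C"
      by (auto simp: W_def)
    show "d \<cdot> y \<in> W" for d
      unfolding W_def using y
      by (intro CollectI exI[of _ "d * c"] exI[of _ "d \<cdot> a"]) (simp add: smul_axioms)
    show "y \<otimes> b \<in> W" if "b \<in> C" for b
      unfolding W_def using y that
      by (intro CollectI exI[of _ 0] exI[of _ "c \<cdot> b \<oplus> a \<otimes> b"])
         (simp add: smul_axioms mul_axioms add_axioms(3))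
    fix z assume "z \<in> W"
    then obtain d b where z: "z = d \<cdot> x \<oplus> x \<otimes> b" "b \<in> C"
      by (auto simp: W_def)
    show "y \<oplus> z \<in> W"
      unfolding W_def using y z
      by (intro CollectI exI[of _ "c + d"] exI[of _ "a \<oplus> b"])
         (simp add: smul_axioms(2) mul_axioms(2) emb_eq_iff emb algebra_simps)
  qed
  then obtain e where e: "e \<in> W" "e \<otimes> e = e" "\<And>x. x \<in> W \<Longrightarrow> e \<otimes> x = x"
    using right_ideal_generated_by_idempotent[OF ss] by blast
  obtain c a where ca: "e = c \<cdot> x \<oplus> x \<otimes> a" "a \<in> C"
    using e(1) by (auto simp: W_def)
  have [simp]: "e \<in> C"
    using ca by simp
  have "x \<in> W"
    unfolding W_def by (intro CollectI exI[of _ 1] exI[of _ \<zero>]) (simp add: smul_axioms(4) emb_eq_iff emb)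
  \<comment> \<open>Multiplying \<open>e = c \<cdot> x \<oplus> x \<otimes> a\<close> on the right
    by \<open>e\<close> absorbs the scalar term and displays \<open>e\<close> itself as a right
    multiple of \<open>x\<close>.\<close>
  have "x \<otimes> (c \<cdot> e \<oplus> a \<otimes> e) = (c \<cdot> x \<oplus> x \<otimes> a) \<otimes> e"
    using ca(2) by (simp add: mul_axioms smul_axioms)
  then have "x \<otimes> (c \<cdot> e \<oplus> a \<otimes> e) \<otimes> x = x"
    using e(2) e(3)[OF \<open>x \<in> W\<close>] by (simp add: ca(1)[symmetric])
  then show "\<exists>y\<in>C. x \<otimes> y \<otimes> x = x"
    using ca(2) by (intro bexI[of _ "c \<cdot> e \<oplus> a \<otimes> e"]) simp_all
qed

text \<open>The whole algebra, as a right ideal, provides a left identity \<open>e\<close>; then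
  \<open>x \<otimes> e \<ominus> x\<close> kills everything on its right, so \<open>e\<close> is a
  right identity too.\<close>

lemma semisimple_unital:
  assumes ss: "fd_semisimple A"
  obtains e where "e \<in> C" "\<And>x. x \<in> C \<Longrightarrow> e \<otimes> x = x" "\<And>x. x \<in> C \<Longrightarrow> x \<otimes> e = x"
proof -
  have "right_ideal A C"
    by (auto simp: right_ideal_def subspace_def)
  then obtain e where e: "e \<in> C" "\<And>x. x \<in> C \<Longrightarrow> e \<otimes> x = x"
    using right_ideal_generated_by_idempotent[OF ss] by blast
  have "x \<otimes> e = x" if x: "x \<in> C" for x
  proof -
    have "(x \<otimes> e \<ominus> x) \<otimes> y = \<zero>" if "y \<in> C" for y
      using that x e by (simp add: mul_diff mul_axioms(1) diff_eq_zero_iff)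
    then show ?thesis
      using left_annihilator_zero[OF ss, of "x \<otimes> e \<ominus> x"] x e by (simp add: diff_eq_zero_iff)
  qed
  then show thesis
    using that e by blast
qed

section \<open>Unit-regularity of semisimple algebras\<close>

text \<open>Otherwise the kernels of the powers of \<open>u\<close> would form a strictly increasing sequence.\<close>

lemma kernel_idempotent_not_in_image:
  assumes fd: "fin_dim A" and u: "u \<in> C" and h: "h \<in> C" "h \<otimes> h = h" "u \<otimes> h = \<zero>" "h \<noteq> \<zero>"
  shows "\<exists>z\<in>C. \<forall>v\<in>C. z \<otimes> h \<noteq> u \<otimes> v"
proof (rule ccontr)
  assume "\<not> ?thesis"
  then have surj: "\<exists>v\<in>C. z \<otimes> h = u \<otimes> v" if "z \<in> C" for z
    using that by blast
  define f where "f = (\<otimes>) u"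
  have fC: "(f ^^ n) x \<in> C" if "x \<in> C" for n x
    using that u by (induction n) (auto simp: f_def)
  have f0: "(f ^^ n) \<zero> = \<zero>" for n
    using u by (induction n) (auto simp: f_def)
  define K where "K n = {x\<in>C. (f ^^ n) x = \<zero>}" for n
  have fhom: "(f ^^ n) (x \<oplus> y) = (f ^^ n) x \<oplus> (f ^^ n) y" "(f ^^ n) (c \<cdot> x) = c \<cdot> (f ^^ n) x"
    if "x \<in> C" "y \<in> C" for x y n c
    using that u fC[OF that(1)] fC[OF that(2)]
    by (induction n) (auto simp: f_def[THEN fun_cong] mul_axioms smul_axioms)
  have "subspace A (K n)" for n
    by (auto simp: subspace_def K_def f0 fhom add_axioms(3))
  then obtain n where n: "\<And>m. \<not> K n \<subset> K m"
    using fin_dim_maximal[OF fd, of "\<lambda>_. True" 0 K] by auto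
  \<comment> \<open>Dividing \<open>h\<close> by \<open>u\<close> can be repeated inside the left
    ideal of \<open>h\<close>. The \<open>n\<close>-th quotient is sent to \<open>h\<close> by the
    \<open>n\<close>-th power of \<open>u\<close> and to zero by the next one.\<close>
  have "\<exists>z\<in>C. z \<otimes> h = z \<and> (f ^^ n) z = h" for n
  proof (induction n)
    case 0
    then show ?case
      using h by auto
  next
    case (Suc n)
    then obtain z where z: "z \<in> C" "z \<otimes> h = z" "(f ^^ n) z = h"
      by auto
    then obtain v where v: "v \<in> C" "u \<otimes> v = z"
      using surj by metis
    have "f (v \<otimes> h) = z"
      using v z u h mul_axioms(1)[of u v h] by (simp add: f_def)
    then show ?case
      using v h z by (intro bexI[of _ "v \<otimes> h"]) (auto simp: funpow_swap1 mul_axioms(1))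
  qed
  then obtain z where z: "z \<in> C" "(f ^^ n) z = h"
    by blast
  have "z \<in> K (Suc n)" "z \<notin> K n"
    using z h by (auto simp: K_def f_def)
  moreover have "K n \<subseteq> K (Suc n)"
    using u by (auto simp: K_def f_def)
  ultimately show False
    using n by blast
qed

lemma semisimple_unit_regular:
  assumes ss: "fd_semisimple A"
  shows "unital_unit_regular A"
proof -
  obtain e where e: "e \<in> C" "\<And>x. x \<in> C \<Longrightarrow> e \<otimes> x = x" "\<And>x. x \<in> C \<Longrightarrow> x \<otimes> e = x"
    using semisimple_unital[OF ss] by blast
  have reg: "\<exists>y\<in>C. x \<otimes> y \<otimes> x = x" if "x \<in> C" for x
    using semisimple_regular[OF ss] that by (auto simp: regular_set_def)
  have C: "subspace A C"
    by (simp add: subspace_def)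
  have "\<exists>u\<in>C. (\<exists>v\<in>C. u \<otimes> v = e \<and> v \<otimes> u = e) \<and> x \<otimes> u \<otimes> x = x" if x: "x \<in> C" for x
  proof -
    define K where "K u = {w\<in>C. u \<otimes> w = \<zero>}" for u
    define P where "P u \<longleftrightarrow> u \<in> C \<and> x \<otimes> u \<otimes> x = x" for u
    obtain u0 where "P u0"
      using reg[OF x] by (auto simp: P_def)
    moreover have "\<And>u. P u \<Longrightarrow> subspace A (K u)"
      using subspace_kernel[OF C] by (simp add: P_def K_def)
    ultimately obtain u where u: "P u" and min: "\<And>u'. P u' \<Longrightarrow> \<not> K u' \<subset> K u"
      using fin_dim_minimal[OF semisimple_fin_dim[OF ss], of P u0 K] by blast
    then have u: "u \<in> C" "x \<otimes> u \<otimes> x = x"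
      by (auto simp: P_def)
    have K0: "w = \<zero>" if w: "w \<in> C" "u \<otimes> w = \<zero>" for w
    proof (rule ccontr)
      assume "w \<noteq> \<zero>"
      obtain w' where w': "w' \<in> C" "w \<otimes> w' \<otimes> w = w"
        using reg w by blast
      define h where "h = w \<otimes> w'"
      have h: "h \<in> C" "h \<otimes> h = h" "u \<otimes> h = \<zero>" "h \<noteq> \<zero>"
        using w w' u \<open>w \<noteq> \<zero>\<close> by (auto simp: h_def mul_axioms(1)[symmetric])
      obtain z where z: "z \<in> C" "\<And>v. v \<in> C \<Longrightarrow> z \<otimes> h \<noteq> u \<otimes> v"
        using kernel_idempotent_not_in_image[OF semisimple_fin_dim[OF ss] u(1) h] by blast
      obtain u1 where u1: "u1 \<in> C" "u \<otimes> u1 \<otimes> u = u"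
        using reg u by blast
      define g where "g = u \<otimes> u1"
      \<comment> \<open>Since \<open>g = u \<otimes> u1\<close> projects onto the image of
        \<open>u\<close>, this is the component of \<open>z \<otimes> h\<close> outside that image;
        it is nonzero by the choice of \<open>z\<close>.\<close>
      define k where "k = z \<otimes> h \<ominus> g \<otimes> (z \<otimes> h)"
      have [simp]: "x \<in> C" "u \<in> C" "h \<in> C" "z \<in> C" "u1 \<in> C" "g \<in> C" "k \<in> C"
        using x u h z u1 by (auto simp: g_def k_def)
      have g: "g \<otimes> u = u" "g \<otimes> g = g"
        using u1 by (auto simp: g_def mul_axioms(1)[symmetric])
      have k: "k \<noteq> \<zero>" "g \<otimes> k = \<zero>" "k \<otimes> h = k"
      proof -
        show "k \<noteq> \<zero>"
          using z(2)[of "u1 \<otimes> (z \<otimes> h)"] by (simp add: k_def diff_eq_zero_iff g_def mul_axioms(1))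
        show "g \<otimes> k = \<zero>"
          using g(2) by (simp add: k_def mul_diff mul_axioms(1)[symmetric] diff_eq_zero_iff)
        show "k \<otimes> h = k"
          using h(2) by (simp add: k_def mul_diff mul_axioms(1))
      qed
      \<comment> \<open>The added term \<open>k * (1 - x * u)\<close> vanishes when multiplied on
        the right by \<open>x\<close>, so \<open>u'\<close> is still an inner inverse. Its values
        avoid the image of \<open>u\<close>, so the kernel cannot grow; and \<open>u'\<close> sends
        \<open>h\<close> to \<open>k\<close>, so \<open>h\<close> leaves the kernel.\<close>
      define u' where "u' = u \<oplus> (k \<ominus> k \<otimes> (x \<otimes> u))"
      have [simp]: "u' \<in> C"
        by (simp add: u'_def)
      have "x \<otimes> u' \<otimes> x = x \<otimes> u \<otimes> x \<oplus> (x \<otimes> k \<otimes> x \<ominus> x \<otimes> k \<otimes> (x \<otimes> u \<otimes> x))"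
        by (simp add: u'_def emb_eq_iff emb algebra_simps)
      then have xu': "x \<otimes> u' \<otimes> x = x"
        using u(2) by (simp add: emb_eq_iff emb)
      have "u \<otimes> y = \<zero>" if "y \<in> C" "u' \<otimes> y = \<zero>" for y
      proof -
        have "g \<otimes> u' = g \<otimes> u \<oplus> (g \<otimes> k \<ominus> g \<otimes> k \<otimes> (x \<otimes> u))"
          by (simp add: u'_def emb_eq_iff emb algebra_simps)
        also have "\<dots> = u"
          using g k by (simp add: emb_eq_iff emb)
        finally have "u \<otimes> y = g \<otimes> (u' \<otimes> y)"
          using that mul_axioms(1)[of g u' y] by simp
        then show ?thesis
          using that by simp
      qed
      moreover have "u' \<otimes> h = u \<otimes> h \<oplus> (k \<otimes> h \<ominus> k \<otimes> (x \<otimes> (u \<otimes> h)))"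
        by (simp add: u'_def emb_eq_iff emb algebra_simps)
      then have "u' \<otimes> h = k"
        using h k by (simp add: add_axioms(3))
      ultimately have "K u' \<subset> K u"
        using h k by (auto simp: K_def)
      then show False
        using min[of u'] xu' by (simp add: P_def)
    qed
    obtain v where v: "v \<in> C" "u \<otimes> v = e"
      using inj_imp_surj[OF semisimple_fin_dim[OF ss] C u(1) _ K0 e(1)] u(1) closed(3) by blast
    have "u \<otimes> (v \<otimes> u \<ominus> e) = \<zero>"
      using u v e by (simp add: mul_diff mul_axioms(1)[symmetric] diff_eq_zero_iff)
    then have "v \<otimes> u = e"
      using K0[of "v \<otimes> u \<ominus> e"] u v e by (simp add: diff_eq_zero_iff)
    then show ?thesis
      using u v by (intro bexI[of _ u] conjI bexI[of _ v])
  qed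
  then show ?thesis
    unfolding unital_unit_regular_def using e by (intro bexI[of _ e]) auto
qed

lemma locally_fdss_imp_locally_unit_regular:
  assumes "locally_fdss A"
  shows "locally_unit_regular A"
  unfolding locally_unit_regular_def
proof (intro allI impI)
  fix F
  assume "finite F \<and> F \<subseteq> C"
  then obtain S where S: "subalgebra A S" "F \<subseteq> S" "fd_semisimple (A\<lparr>carrier := S\<rparr>)"
    using assms unfolding locally_fdss_def by metis
  then have "unital_unit_regular (A\<lparr>carrier := S\<rparr>)"
    by (intro algebra.semisimple_unit_regular algebra.intro subalgebra_is_algebra)
  then show "\<exists>S. subalgebra A S \<and> F \<subseteq> S \<and> unital_unit_regular (A\<lparr>carrier := S\<rparr>)"
    using S by metis
qed

end

section \<open>Identities for lifting units and idempotents\<close>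

text \<open>Here \<open>q\<close> is an inverse of \<open>x\<close> modulo an ideal containing \<open>j\<close>, and \<open>x\<close> leaves the kernel of \<open>j\<close>
  invariant and acts invertibly on it, so \<open>x\<close> becomes a unit on replacing it by the identity on the
  complement \<open>f\<close> of that kernel.\<close>

lemma unit_lift_identity:
  fixes e x q g :: "'a::ring"
  defines "j \<equiv> e - x * q"
  defines "f \<equiv> g * j"
  assumes e: "e * x = x" "x * e = x" "e * q = q" "q * e = q" "e * g = g"
    and comm: "x * q = q * x" and g: "j * g * j = j"
  shows "(x - x * f + f) * (q - q * f + f) = e" "(q - q * f + f) * (x - x * f + f) = e"
proof -
  have jx: "j * x = x * j" "j * q = q * j"
    by (simp_all add: j_def left_diff_distrib right_diff_distrib e mult.assoc comm mult_assoc_eq[OF comm])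
  have jf: "j * f = j"
    using g by (simp add: f_def mult.assoc)
  have ff: "f * f = f"
    using jf by (simp add: f_def mult.assoc)
  have ef: "e * f = f"
    by (simp add: f_def e flip: mult.assoc)
  \<comment> \<open>In other words \<open>f * z * (1 - f) = 0\<close>: the kernel of
    \<open>f\<close>, which is that of \<open>j\<close>, is invariant under every element commuting
    with \<open>j\<close>, in particular under \<open>x\<close> and \<open>q\<close>.\<close>
  have fzf: "f * (z * f) = f * z" if z: "j * z = z * j" for z
  proof -
    have "f * (z * f) = g * (j * z * f)"
      by (simp add: f_def mult.assoc)
    also have "\<dots> = g * (z * (j * f))"
      unfolding z by (simp add: mult.assoc)
    also have "\<dots> = f * z"
      unfolding jf z[symmetric] by (simp add: f_def mult.assoc)
    finally show ?thesis .
  qed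
  note fxf = fzf[OF jx(1)] fzf[OF jx(2)]
  have key: "e - x * q = j" "e - j * f = x * q" "e - j = x * q"
    by (simp_all add: jf) (simp_all add: j_def)
  have "x * q * f = f - j"
    unfolding key(3)[symmetric] by (simp add: left_diff_distrib ef jf)
  then have "x * q - x * q * f + f = e"
    by (simp add: j_def)
  then have A: "x * q - x * (q * f) + f = e"
    by (simp add: mult.assoc)
  have "(x - x * f + f) * (q - q * f + f) = x * q - x * (q * f) + f"
    by (simp add: distrib_left distrib_right left_diff_distrib right_diff_distrib mult.assoc ff fxf)
  then show "(x - x * f + f) * (q - q * f + f) = e"
    using A by simp
  have "(q - q * f + f) * (x - x * f + f) = q * x - q * x * f + f"
    by (simp add: distrib_left distrib_right left_diff_distrib right_diff_distrib mult.assoc ff fxf)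
  then show "(q - q * f + f) * (x - x * f + f) = e"
    using A by (simp add: comm mult_assoc_eq[OF comm] mult.assoc)
qed

text \<open>On the kernel of \<open>j\<close>, which is that of the idempotent \<open>f\<close>, the
  element \<open>x\<close> acts as an idempotent, and \<open>d = x * (1 - f)\<close> extends this
  action by zero. The rest \<open>x * f\<close> is \<open>y\<close> plus the off-diagonal term
  \<open>n\<close>. As \<open>n * n = 0\<close> and \<open>x * n = n\<close>, right multiplication
  by the unit \<open>e - n\<close> is a column operation that clears \<open>n\<close> and leaves the
  orthogonal sum \<open>d + y\<close>.\<close>

lemma idempotent_split:
  fixes e x g :: "'a::ring"
  defines "j \<equiv> x - x * x"
  defines "f \<equiv> g * j"
  defines "d \<equiv> x - x * f"
  defines "n \<equiv> d * x * f" and "y \<equiv> x * f - d * x * f"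
  assumes e: "e * x = x" "x * e = x" "e * e = e" "e * g = g" and g: "j * g * j = j"
  shows "d * d = d" "d * y = 0" "y * d = 0" "x * (e - n) = d + y"
    "(e - n) * (e + n) = e" "(e + n) * (e - n) = e"
proof -
  have jx: "j * x = x * j"
    by (simp add: j_def left_diff_distrib right_diff_distrib mult.assoc)
  have jf: "j * f = j"
    using g by (simp add: f_def mult.assoc)
  have ff: "f * f = f"
    using jf by (simp add: f_def mult.assoc)
  have je: "j * e = j"
    by (simp add: j_def left_diff_distrib e mult.assoc)
  have fe: "f * e = f"
    by (simp add: f_def mult.assoc je)
  have fzf: "f * (z * f) = f * z" if z: "j * z = z * j" for z
  proof -
    have "f * (z * f) = g * (j * z * f)"
      by (simp add: f_def mult.assoc)
    also have "\<dots> = g * (z * (j * f))"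
      unfolding z by (simp add: mult.assoc)
    also have "\<dots> = f * z"
      unfolding jf z[symmetric] by (simp add: f_def mult.assoc)
    finally show ?thesis .
  qed
  note fxf = fzf[OF jx]
  have fd: "f * d = 0"
    by (simp add: d_def right_diff_distrib fxf)
  have xx: "x * x = x - j"
    by (simp add: j_def)
  have "x * d = x * x - x * x * f"
    by (simp add: d_def right_diff_distrib mult.assoc)
  also have "\<dots> = d"
    unfolding xx by (simp add: d_def left_diff_distrib jf)
  finally have xd: "x * d = d" .
  show dd: "d * d = d"
    unfolding d_def left_diff_distrib
    by (simp add: d_def[symmetric] xd mult.assoc fd)
  show "d * y = 0"
    by (simp add: y_def right_diff_distrib dd flip: mult.assoc)
  show "y * d = 0"
    by (simp add: y_def left_diff_distrib mult.assoc fd)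
  have nn: "n * n = 0"
    by (simp add: n_def mult.assoc mult_assoc_eq[OF fd])
  have en: "e * n = n" "n * e = n"
    by (simp_all add: n_def d_def left_diff_distrib right_diff_distrib mult.assoc fe mult_assoc_eq[OF e(1)])
  have "x * n = n"
    by (simp add: n_def mult.assoc mult_assoc_eq[OF xd])
  then show "x * (e - n) = d + y"
    by (simp add: right_diff_distrib e y_def n_def) (simp add: d_def)
  show "(e - n) * (e + n) = e" "(e + n) * (e - n) = e"
    by (simp_all add: distrib_left distrib_right left_diff_distrib right_diff_distrib e en nn)
qed

text \<open>With respect to \<open>h\<close> and \<open>e - h\<close> the element
  \<open>d + y\<close> is block diagonal. The unit \<open>p\<close> handles the block of
  \<open>y\<close>, and in the complementary block the identity \<open>e - h\<close> is an inner
  inverse of the idempotent \<open>d\<close>.\<close>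

lemma orthogonal_sum_unit_regular:
  fixes e d h y p q :: "'a::ring"
  assumes d: "d * d = d" "d * h = 0" "h * d = 0" "d * e = d" "e * d = d"
    and h: "h * h = h" "h * e = h" "e * h = h" "h * y = y" "y * h = y"
    and p: "h * p = p" "p * h = p" "h * q = q" "q * h = q" "p * q = h" "q * p = h" "y * p * y = y"
    and e: "e * e = e"
  shows "(p + (e - h)) * (q + (e - h)) = e" "(q + (e - h)) * (p + (e - h)) = e"
    "(d + y) * (p + (e - h)) * (d + y) = d + y"
proof -
  have e': "p * e = p" "e * p = p" "q * e = q" "e * q = q" "y * e = y" "e * y = y"
    using mult.assoc[of p h e] mult.assoc[of e h p] mult.assoc[of q h e] mult.assoc[of e h q]
      mult.assoc[of y h e] mult.assoc[of e h y] by (simp_all add: p h)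
  have 0: "p * d = 0" "d * p = 0" "y * d = 0" "d * y = 0"
    using mult.assoc[of p h d] mult.assoc[of d h p] mult.assoc[of y h d] mult.assoc[of d h y]
    by (simp_all add: p h d)
  show "(p + (e - h)) * (q + (e - h)) = e" "(q + (e - h)) * (p + (e - h)) = e"
    by (simp_all add: distrib_left distrib_right left_diff_distrib right_diff_distrib p e' h e)
  show "(d + y) * (p + (e - h)) * (d + y) = d + y"
    using p(7) by (simp add: mult.assoc distrib_left distrib_right left_diff_distrib right_diff_distrib d h e' 0)
qed

section \<open>Extensions\<close>

text \<open>Extensions are handled as surjective homomorphisms instead of quotients: this covers the
  quotient map, its composition with an isomorphism, and its restriction to a corner.\<close>

definition alg_hom :: "('k::field, 'a) alg \<Rightarrow> ('k, 'b) alg \<Rightarrow> ('a \<Rightarrow> 'b) \<Rightarrow> bool" where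
  "alg_hom A Q \<phi> \<longleftrightarrow> (\<forall>x\<in>carrier A. \<phi> x \<in> carrier Q) \<and>
     (\<forall>x\<in>carrier A. \<forall>y\<in>carrier A. \<phi> (add A x y) = add Q (\<phi> x) (\<phi> y) \<and>
                                    \<phi> (mul A x y) = mul Q (\<phi> x) (\<phi> y)) \<and>
     (\<forall>c. \<forall>x\<in>carrier A. \<phi> (smul A c x) = smul Q c (\<phi> x))"

definition hom_kernel :: "('k::field, 'a) alg \<Rightarrow> ('k, 'b) alg \<Rightarrow> ('a \<Rightarrow> 'b) \<Rightarrow> 'a set" where
  "hom_kernel A Q \<phi> = {x\<in>carrier A. \<phi> x = zero Q}"

lemma alg_idealD:
  assumes "alg_ideal A J"
  shows "x \<in> J \<Longrightarrow> x \<in> carrier A" "zero A \<in> J" "x \<in> J \<Longrightarrow> y \<in> J \<Longrightarrow> add A x y \<in> J"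
    "x \<in> J \<Longrightarrow> y \<in> J \<Longrightarrow> diff A x y \<in> J" "x \<in> J \<Longrightarrow> smul A c x \<in> J"
    "r \<in> carrier A \<Longrightarrow> x \<in> J \<Longrightarrow> mul A r x \<in> J" "r \<in> carrier A \<Longrightarrow> x \<in> J \<Longrightarrow> mul A x r \<in> J"
  using assms by (auto simp: alg_ideal_def diff_def)

lemma alg_ideal_subalgebra: "alg_ideal A J \<Longrightarrow> subalgebra A J"
  by (auto simp: alg_ideal_def subalgebra_def)

context algebra
begin

lemma alg_homD:
  assumes "algebra Q" "alg_hom A Q \<phi>"
  shows "x \<in> C \<Longrightarrow> \<phi> x \<in> carrier Q" "x \<in> C \<Longrightarrow> y \<in> C \<Longrightarrow> \<phi> (x \<oplus> y) = add Q (\<phi> x) (\<phi> y)"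
    "x \<in> C \<Longrightarrow> y \<in> C \<Longrightarrow> \<phi> (x \<otimes> y) = mul Q (\<phi> x) (\<phi> y)" "x \<in> C \<Longrightarrow> \<phi> (c \<cdot> x) = smul Q c (\<phi> x)"
    "x \<in> C \<Longrightarrow> y \<in> C \<Longrightarrow> \<phi> (x \<ominus> y) = diff Q (\<phi> x) (\<phi> y)" "\<phi> \<zero> = zero Q"
proof -
  show *: "x \<in> C \<Longrightarrow> \<phi> x \<in> carrier Q" "x \<in> C \<Longrightarrow> y \<in> C \<Longrightarrow> \<phi> (x \<oplus> y) = add Q (\<phi> x) (\<phi> y)"
    "x \<in> C \<Longrightarrow> y \<in> C \<Longrightarrow> \<phi> (x \<otimes> y) = mul Q (\<phi> x) (\<phi> y)" "x \<in> C \<Longrightarrow> \<phi> (c \<cdot> x) = smul Q c (\<phi> x)" for x y c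
    using assms(2) by (auto simp: alg_hom_def)
  show "x \<in> C \<Longrightarrow> y \<in> C \<Longrightarrow> \<phi> (x \<ominus> y) = diff Q (\<phi> x) (\<phi> y)"
    using * by (simp add: diff_def)
  show "\<phi> \<zero> = zero Q"
    using *(4)[of \<zero> 0] *(1)[of \<zero>] algebra.smul_zero[OF assms(1)] by simp
qed

lemma hom_kernel_ideal:
  assumes Q: "algebra Q" and hom: "alg_hom A Q \<phi>"
  shows "alg_ideal A (hom_kernel A Q \<phi>)"
  using alg_homD[OF assms] algebra.mul_zero[OF Q] algebra.smul_zero[OF Q]
    algebra.add_axioms(3)[OF Q] algebra.closed(1)[OF Q]
  by (auto simp: alg_ideal_def hom_kernel_def)

lemma hom_kernel_iff:
  assumes Q: "algebra Q" and hom: "alg_hom A Q \<phi>" and "x \<in> C" "y \<in> C"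
  shows "x \<ominus> y \<in> hom_kernel A Q \<phi> \<longleftrightarrow> \<phi> x = \<phi> y"
  using alg_homD(5)[OF Q hom assms(3,4)] assms(3,4)
    algebra.diff_eq_zero_iff[OF Q alg_homD(1)[OF Q hom assms(3)] alg_homD(1)[OF Q hom assms(4)]]
  by (simp add: hom_kernel_def)

text \<open>The image \<open>V\<close> of the centraliser of a preimage \<open>x\<close> of \<open>a\<close> is finite dimensional and stable under the
  injective multiplication by \<open>a\<close>; hence the inverse of \<open>a\<close> has a preimage \<open>q\<close> that commutes with \<open>x\<close>.\<close>

lemma unit_lift:
  assumes Q: "algebra Q" and hom: "alg_hom A Q \<phi>" and surj: "\<phi> ` C = carrier Q" and fd: "fin_dim Q"
    and e: "e \<in> C" "\<And>x. x \<in> C \<Longrightarrow> e \<otimes> x = x" "\<And>x. x \<in> C \<Longrightarrow> x \<otimes> e = x"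
    and reg: "regular_set A (hom_kernel A Q \<phi>)"
    and ab: "a \<in> carrier Q" "b \<in> carrier Q" "mul Q b a = \<phi> e"
  obtains u v where "u \<in> C" "v \<in> C" "u \<otimes> v = e" "v \<otimes> u = e" "\<phi> u = a"
proof -
  note h = alg_homD[OF Q hom]
  note Qm = algebra.mul_axioms[OF Q]
  note J = alg_idealD[OF hom_kernel_ideal[OF Q hom]]
  obtain x where x: "x \<in> C" "\<phi> x = a"
    using ab(1) unfolding surj[symmetric] by auto
  define Z where "Z = {q\<in>C. x \<otimes> q = q \<otimes> x}"
  define V where "V = \<phi> ` Z"
  have Z: "subspace A Z"
    using x by (auto simp: subspace_def Z_def mul_axioms smul_axioms)
  have eZ: "e \<in> Z"
    using e x by (simp add: Z_def)
  have idQ: "mul Q (\<phi> e) c = c" if c: "c \<in> carrier Q" for c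
  proof -
    obtain z where "z \<in> C" "\<phi> z = c"
      using c unfolding surj[symmetric] by auto
    then show ?thesis
      using h(3)[of e z] e by simp
  qed
  have V: "subspace Q V"
    unfolding subspace_def
  proof (intro conjI ballI allI)
    show "V \<subseteq> carrier Q"
      using h(1) by (auto simp: V_def Z_def)
    show "zero Q \<in> V"
      unfolding V_def using h(6) subspaceD(2)[OF Z] by (intro image_eqI[of _ _ \<zero>]) simp_all
    fix s c
    assume "s \<in> V"
    then obtain p where p: "p \<in> Z" "s = \<phi> p"
      by (auto simp: V_def)
    show "smul Q c s \<in> V"
      unfolding V_def using p subspaceD[OF Z] h(4) by (intro image_eqI[of _ _ "c \<cdot> p"]) simp_all
    fix t
    assume "t \<in> V"
    then obtain q where q: "q \<in> Z" "t = \<phi> q"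
      by (auto simp: V_def)
    show "add Q s t \<in> V"
      unfolding V_def using p q subspaceD[OF Z] h(2) by (intro image_eqI[of _ _ "p \<oplus> q"]) simp_all
  qed
  have VQ: "s \<in> carrier Q" if "s \<in> V" for s
    using V that by (auto simp: subspace_def)
  have stab: "mul Q a s \<in> V" if s: "s \<in> V" for s
  proof -
    obtain q where q: "q \<in> C" "x \<otimes> q = q \<otimes> x" "s = \<phi> q"
      using s by (auto simp: V_def Z_def)
    have "x \<otimes> q \<in> Z"
      using q x mul_axioms(1)[of x q x] by (simp add: Z_def)
    then show ?thesis
      unfolding V_def using h(3)[of x q] q x by (intro image_eqI[of _ _ "x \<otimes> q"]) simp_all
  qed
  have inj: "s = zero Q" if s: "s \<in> V" "mul Q a s = zero Q" for s
    using Qm(1)[of b a s] idQ[of s] VQ[OF s(1)] ab s algebra.mul_zero(2)[OF Q, of b] by simp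
  have "\<phi> e \<in> V"
    using eZ by (simp add: V_def)
  from algebra.inj_imp_surj[OF Q fd V ab(1) stab inj this] have "\<exists>s\<in>V. mul Q a s = \<phi> e" .
  then obtain q where q: "q \<in> C" "x \<otimes> q = q \<otimes> x" "mul Q a (\<phi> q) = \<phi> e"
    by (auto simp: V_def Z_def)
  define j where "j = e \<ominus> x \<otimes> q"
  have j: "j \<in> hom_kernel A Q \<phi>"
    unfolding j_def using e(1) x q h(3)[of x q] by (subst hom_kernel_iff[OF Q hom]) simp_all
  then obtain g where g: "g \<in> hom_kernel A Q \<phi>" "j \<otimes> g \<otimes> j = j"
    using reg by (auto simp: regular_set_def)
  define f where "f = g \<otimes> j"
  have f: "f \<in> hom_kernel A Q \<phi>"
    using J g j by (simp add: f_def)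
  have [simp]: "e \<in> C" "x \<in> C" "q \<in> C" "j \<in> C" "g \<in> C" "f \<in> C"
    using e x q J(1)[OF j] J(1)[OF g(1)] J(1)[OF f] by auto
  have t: "\<iota> e * \<iota> x = \<iota> x" "\<iota> x * \<iota> e = \<iota> x" "\<iota> e * \<iota> q = \<iota> q" "\<iota> q * \<iota> e = \<iota> q"
    "\<iota> e * \<iota> g = \<iota> g" "\<iota> x * \<iota> q = \<iota> q * \<iota> x"
    using e(2,3) q(2) by (simp_all add: emb(3)[symmetric])
  have ij: "\<iota> j = \<iota> e - \<iota> x * \<iota> q"
    by (simp add: j_def emb)
  have "\<iota> j * \<iota> g * \<iota> j = \<iota> j"
    using g(2) by (simp add: emb(3)[symmetric])
  note id = unit_lift_identity[OF t this[unfolded ij], folded ij]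
  define u where "u = x \<ominus> x \<otimes> f \<oplus> f"
  define v where "v = q \<ominus> q \<otimes> f \<oplus> f"
  have uv: "u \<in> C" "v \<in> C" "u \<otimes> v = e" "v \<otimes> u = e"
    using id by (simp_all add: u_def v_def f_def emb_eq_iff emb)
  \<comment> \<open>The modification of \<open>x\<close> takes place inside the kernel of
    \<open>\<phi>\<close>, so \<open>u\<close> is still a preimage of \<open>a\<close>.\<close>
  have "u \<ominus> x = f \<ominus> x \<otimes> f"
    by (simp add: u_def emb_eq_iff emb)
  then have "u \<ominus> x \<in> hom_kernel A Q \<phi>"
    using J f by simp
  then have "\<phi> u = a"
    using hom_kernel_iff[OF Q hom uv(1) x(1)] x(2) by simp
  then show thesis
    by (rule that[OF uv])
qed

lemma locally_unit_regular_ideal_regular: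
  assumes J: "alg_ideal A J" and lur: "locally_unit_regular (A\<lparr>carrier := J\<rparr>)"
  shows "regular_set A J"
  unfolding regular_set_def
proof
  fix x
  assume "x \<in> J"
  then obtain T where T: "T \<subseteq> J" "x \<in> T" "unital_unit_regular (A\<lparr>carrier := T\<rparr>)"
    using lur[unfolded locally_unit_regular_def, rule_format, of "{x}"]
    by (auto simp: subalgebra_def)
  then obtain u where "u \<in> T" "x \<otimes> u \<otimes> x = x"
    by (auto simp: unital_unit_regular_def)
  then show "\<exists>y\<in>J. x \<otimes> y \<otimes> x = x"
    using T(1) by (intro bexI[of _ u]) auto
qed

text \<open>The subalgebra \<open>T\<close> around \<open>h\<close> and \<open>y\<close> has an
  identity \<open>g\<close> of its own that may be larger than \<open>h\<close>;
  \<open>corner_unit_regular\<close> descends from \<open>g\<close> to \<open>h\<close>. Its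
  formulas are evaluated within \<open>T\<close>, so \<open>p\<close> and \<open>q\<close> stay in
  \<open>J\<close>.\<close>

lemma locally_unit_regular_corner:
  assumes J: "alg_ideal A J" and lur: "locally_unit_regular (A\<lparr>carrier := J\<rparr>)"
    and h: "h \<in> J" "h \<otimes> h = h" and y: "y \<in> J" "h \<otimes> y = y" "y \<otimes> h = y"
  shows "\<exists>p\<in>J. \<exists>q\<in>J. h \<otimes> p = p \<and> p \<otimes> h = p \<and> h \<otimes> q = q \<and> q \<otimes> h = q \<and>
           p \<otimes> q = h \<and> q \<otimes> p = h \<and> y \<otimes> p \<otimes> y = y"
proof -
  have "finite {h, y} \<and> {h, y} \<subseteq> J"
    using h y by simp
  then obtain T where T: "subalgebra (A\<lparr>carrier := J\<rparr>) T" "h \<in> T" "y \<in> T"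
      "unital_unit_regular (A\<lparr>carrier := T\<rparr>)"
    using lur[unfolded locally_unit_regular_def, rule_format, of "{h, y}"] by auto
  have TJ: "T \<subseteq> J"
    using T(1) by (simp add: subalgebra_def)
  have sub: "subalgebra A T"
    using T(1) alg_idealD(1)[OF J] by (auto simp: subalgebra_def)
  note c = subalgebraD[OF sub]
  obtain g where g: "g \<in> T" "\<And>x. x \<in> T \<Longrightarrow> g \<otimes> x = x" "\<And>x. x \<in> T \<Longrightarrow> x \<otimes> g = x"
    and ur: "\<And>x. x \<in> T \<Longrightarrow> \<exists>u\<in>T. (\<exists>v\<in>T. u \<otimes> v = g \<and> v \<otimes> u = g) \<and> x \<otimes> u \<otimes> x = x"
    using T(4) by (auto simp: unital_unit_regular_def)
  define b where "b = y \<oplus> g \<ominus> h"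
  have b: "b \<in> T"
    unfolding b_def by (intro c g(1) T)
  obtain w where w: "w \<in> T" "\<exists>v\<in>T. w \<otimes> v = g \<and> v \<otimes> w = g" "b \<otimes> w \<otimes> b = b"
    using ur[OF b] by auto
  obtain v where v: "v \<in> T" "w \<otimes> v = g" "v \<otimes> w = g"
    using w(2) by auto
  have [simp]: "g \<in> C" "h \<in> C" "y \<in> C" "b \<in> C" "w \<in> C" "v \<in> C"
    using c(1)[OF g(1)] c(1)[OF T(2)] c(1)[OF T(3)] c(1)[OF b] c(1)[OF w(1)] c(1)[OF v(1)] by auto
  have ib: "\<iota> b = \<iota> y + \<iota> g - \<iota> h"
    by (simp add: b_def emb)
  have t: "\<iota> h * \<iota> h = \<iota> h" "\<iota> g * \<iota> h = \<iota> h" "\<iota> h * \<iota> g = \<iota> h" "\<iota> h * \<iota> y = \<iota> y" "\<iota> y * \<iota> h = \<iota> y"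
    "\<iota> g * \<iota> g = \<iota> g" "\<iota> g * \<iota> w = \<iota> w" "\<iota> w * \<iota> g = \<iota> w" "\<iota> g * \<iota> v = \<iota> v" "\<iota> v * \<iota> g = \<iota> v"
    "\<iota> w * \<iota> v = \<iota> g" "\<iota> v * \<iota> w = \<iota> g"
    using h(2) y(2,3) v(2,3) g(2)[OF g(1)] g(2)[OF T(2)] g(3)[OF T(2)] g(2)[OF w(1)] g(3)[OF w(1)]
      g(2)[OF v(1)] g(3)[OF v(1)] by (simp_all add: emb(3)[symmetric])
  have "\<iota> b * \<iota> w * \<iota> b = \<iota> b"
    using w(3) by (simp add: emb(3)[symmetric])
  note id = corner_unit_regular[OF t this[unfolded ib], folded ib]
  define p where "p = h \<otimes> w \<otimes> y \<otimes> w \<otimes> h \<oplus> (w \<ominus> w \<otimes> b \<otimes> w) \<otimes> (h \<ominus> y \<otimes> w \<otimes> h)"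
  define q where "q = y \<oplus> (h \<ominus> y \<otimes> w \<otimes> h) \<otimes> v \<otimes> (h \<ominus> h \<otimes> w \<otimes> y)"
  have "p \<in> T" "q \<in> T"
    unfolding p_def q_def by (intro c T w(1) v(1) b)+
  then have pq: "p \<in> J" "q \<in> J"
    using TJ by auto
  have [simp]: "p \<in> C" "q \<in> C"
    by (simp_all add: p_def q_def)
  have ip: "\<iota> p = \<iota> h * \<iota> w * \<iota> y * \<iota> w * \<iota> h + (\<iota> w - \<iota> w * \<iota> b * \<iota> w) * (\<iota> h - \<iota> y * \<iota> w * \<iota> h)"
    by (simp add: p_def emb)
  have iq: "\<iota> q = \<iota> y + (\<iota> h - \<iota> y * \<iota> w * \<iota> h) * \<iota> v * (\<iota> h - \<iota> h * \<iota> w * \<iota> y)"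
    by (simp add: q_def emb)
  note id' = id[folded ip iq]
  have "h \<otimes> p = p" "p \<otimes> h = p" "h \<otimes> q = q" "q \<otimes> h = q" "p \<otimes> q = h" "q \<otimes> p = h" "y \<otimes> p \<otimes> y = y"
    using id' by (simp_all add: emb_eq_iff emb)
  with pq show ?thesis
    by (intro bexI[of _ p] bexI[of _ q] conjI)
qed

lemma unital_extension_unit_regular:
  assumes Q: "algebra Q" and hom: "alg_hom A Q \<phi>" and surj: "\<phi> ` C = carrier Q" and fd: "fin_dim Q"
    and ur: "unital_unit_regular Q"
    and e: "e \<in> C" "\<And>x. x \<in> C \<Longrightarrow> e \<otimes> x = x" "\<And>x. x \<in> C \<Longrightarrow> x \<otimes> e = x"
    and reg: "regular_set A (hom_kernel A Q \<phi>)"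
    and corner: "\<And>h y. h \<in> hom_kernel A Q \<phi> \<Longrightarrow> h \<otimes> h = h \<Longrightarrow> y \<in> hom_kernel A Q \<phi> \<Longrightarrow>
      h \<otimes> y = y \<Longrightarrow> y \<otimes> h = y \<Longrightarrow> \<exists>p\<in>C. \<exists>q\<in>C.
           h \<otimes> p = p \<and> p \<otimes> h = p \<and> h \<otimes> q = q \<and> q \<otimes> h = q \<and>
           p \<otimes> q = h \<and> q \<otimes> p = h \<and> y \<otimes> p \<otimes> y = y"
  shows "unital_unit_regular A"
proof -
  define J where "J = hom_kernel A Q \<phi>"
  note H = alg_homD[OF Q hom]
  have JI: "alg_ideal A J"
    unfolding J_def by (rule hom_kernel_ideal[OF Q hom])
  note J = alg_idealD[OF JI]
  obtain \<epsilon> where \<epsilon>: "\<epsilon> \<in> carrier Q" "\<And>x. x \<in> carrier Q \<Longrightarrow> mul Q \<epsilon> x = x" "\<And>x. x \<in> carrier Q \<Longrightarrow> mul Q x \<epsilon> = x"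
    and urQ: "\<And>x. x \<in> carrier Q \<Longrightarrow> \<exists>u\<in>carrier Q.
      (\<exists>v\<in>carrier Q. mul Q u v = \<epsilon> \<and> mul Q v u = \<epsilon>) \<and> mul Q (mul Q x u) x = x"
    using ur by (auto simp: unital_unit_regular_def)
  have "\<epsilon> \<in> \<phi> ` C"
    using \<epsilon>(1) surj by simp
  then obtain z where z: "z \<in> C" "\<phi> z = \<epsilon>"
    by auto
  have \<phi>e: "\<phi> e = \<epsilon>"
    using H(3)[of e z] H(1)[of e] e(1) e(2)[of z] \<epsilon>(3)[of "\<phi> e"] z by simp
  have "\<exists>u\<in>C. (\<exists>v\<in>C. u \<otimes> v = e \<and> v \<otimes> u = e) \<and> x \<otimes> u \<otimes> x = x" if x: "x \<in> C" for x
  proof -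
    obtain a where a: "a \<in> carrier Q" "\<exists>b\<in>carrier Q. mul Q a b = \<epsilon> \<and> mul Q b a = \<epsilon>"
        "mul Q (mul Q (\<phi> x) a) (\<phi> x) = \<phi> x"
      using urQ[OF H(1)[OF x]] by auto
    then obtain b where b: "b \<in> carrier Q" "mul Q b a = \<phi> e"
      using \<phi>e by auto
    obtain u v where u: "u \<in> C" "v \<in> C" "u \<otimes> v = e" "v \<otimes> u = e" "\<phi> u = a"
      by (rule unit_lift[OF Q hom surj fd e reg a(1) b])
    \<comment> \<open>As \<open>u\<close> lifts a unit inner inverse of \<open>\<phi> x\<close>, the
      image of \<open>s\<close> is idempotent.\<close>
    define s where "s = x \<otimes> u"
    have s: "s \<in> C"
      using x u by (simp add: s_def)
    have "mul Q (\<phi> s) (\<phi> s) = mul Q (mul Q (mul Q (\<phi> x) a) (\<phi> x)) a"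
      using x u a(1) H by (simp add: s_def algebra.mul_axioms(1)[OF Q] algebra.closed(3)[OF Q])
    also have "\<dots> = \<phi> s"
      unfolding a(3) using x u H(3) by (simp add: s_def)
    finally have "\<phi> s = \<phi> (s \<otimes> s)"
      using s H(3) by simp
    define j where "j = s \<ominus> s \<otimes> s"
    have j: "j \<in> J"
      unfolding j_def J_def using s \<open>\<phi> s = \<phi> (s \<otimes> s)\<close> by (subst hom_kernel_iff[OF Q hom]) simp_all
    then obtain g where g: "g \<in> J" "j \<otimes> g \<otimes> j = j"
      using reg by (auto simp: regular_set_def J_def)
    define f where "f = g \<otimes> j"
    define d where "d = s \<ominus> s \<otimes> f"
    define n where "n = d \<otimes> s \<otimes> f"
    define y where "y = s \<otimes> f \<ominus> d \<otimes> s \<otimes> f"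
    have f: "f \<in> J"
      using J g j by (simp add: f_def)
    have [simp]: "e \<in> C" "x \<in> C" "s \<in> C" "u \<in> C" "v \<in> C" "j \<in> C" "g \<in> C" "f \<in> C"
      using e x u s J(1)[OF j] J(1)[OF g(1)] J(1)[OF f] by auto
    have [simp]: "d \<in> C" "n \<in> C" "y \<in> C"
      by (simp_all add: d_def n_def y_def)
    have y: "y \<in> J"
      unfolding y_def by (intro J(4) J(6) f) simp_all
    have ij: "\<iota> j = \<iota> s - \<iota> s * \<iota> s" "\<iota> f = \<iota> g * \<iota> j" "\<iota> d = \<iota> s - \<iota> s * \<iota> f"
      "\<iota> n = \<iota> d * \<iota> s * \<iota> f" "\<iota> y = \<iota> s * \<iota> f - \<iota> d * \<iota> s * \<iota> f"
      by (simp_all add: j_def f_def d_def n_def y_def emb)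
    have t: "\<iota> e * \<iota> s = \<iota> s" "\<iota> s * \<iota> e = \<iota> s" "\<iota> e * \<iota> e = \<iota> e" "\<iota> e * \<iota> g = \<iota> g"
      using e(2,3) by (simp_all add: emb(3)[symmetric])
    have tg: "\<iota> j * \<iota> g * \<iota> j = \<iota> j"
      using g(2) by (simp add: emb(3)[symmetric])
    have "d \<otimes> d = d" "d \<otimes> y = \<zero>" "y \<otimes> d = \<zero>" and sn: "s \<otimes> (e \<ominus> n) = d \<oplus> y"
      and n: "(e \<ominus> n) \<otimes> (e \<oplus> n) = e" "(e \<oplus> n) \<otimes> (e \<ominus> n) = e"
      using idempotent_split[OF t tg[unfolded ij(1)], folded ij(1), folded ij(2), folded ij(3), folded ij(4,5)]
      by (simp_all add: emb_eq_iff emb(1-2) emb(3)[of _ _] emb(4))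
    note dy = this(1-3)
    \<comment> \<open>Taking the local identity \<open>h\<close> of \<open>y\<close> from the
      annihilator of \<open>d\<close> makes \<open>h\<close> orthogonal to \<open>d\<close>; a local
      identity taken from \<open>J\<close> alone could overlap with \<open>d\<close>.\<close>
    define B where "B = {z\<in>J. d \<otimes> z = \<zero> \<and> z \<otimes> d = \<zero>}"
    have B: "subalgebra A B"
      using J by (auto simp: subalgebra_def B_def mul_axioms smul_axioms add_axioms(3) mul_axioms(1)[of d, symmetric])
    have "regular_set A B"
      unfolding regular_set_def
    proof
      fix w
      assume "w \<in> B"
      then have w: "w \<in> J" "d \<otimes> w = \<zero>" "w \<otimes> d = \<zero>"
        by (auto simp: B_def)
      then obtain r where r: "r \<in> J" "w \<otimes> r \<otimes> w = w"
        using reg by (auto simp: regular_set_def J_def)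
      have [simp]: "w \<in> C" "r \<in> C"
        using J(1) w r by auto
      \<comment> \<open>This is \<open>(1 - d) * r * (1 - d)\<close>, expanded. It annihilates
        \<open>d\<close>, and it is still an inner inverse of \<open>w\<close> because
        \<open>w\<close> is killed by \<open>d\<close> on both sides.\<close>
      define r' where "r' = r \<ominus> d \<otimes> r \<ominus> r \<otimes> d \<oplus> d \<otimes> r \<otimes> d"
      have i: "\<iota> d * \<iota> d = \<iota> d" "\<iota> d * \<iota> w = 0" "\<iota> w * \<iota> d = 0" "\<iota> w * \<iota> r * \<iota> w = \<iota> w"
        using dy w(2,3) r(2) by (simp_all add: emb(1,3)[symmetric])
      note i' = i(1-3) i(1-3)[THEN mult_assoc_eq] i(4)[unfolded mult.assoc]
      have "r' \<in> J"
        unfolding r'_def using J(6)[of d r] J(7)[of d r] J(7)[of d "d \<otimes> r"] r(1)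
        by (intro J(3,4)) simp_all
      moreover have "d \<otimes> r' = \<zero>" "r' \<otimes> d = \<zero>" "w \<otimes> r' \<otimes> w = w"
        by (simp_all add: r'_def emb_eq_iff emb algebra_simps i')
      ultimately show "\<exists>r\<in>B. w \<otimes> r \<otimes> w = w"
        by (intro bexI[of _ r']) (simp_all add: B_def)
    qed
    moreover have "y \<in> B"
      using y dy by (simp add: B_def)
    ultimately obtain h where h: "h \<in> B" "h \<otimes> h = h" "h \<otimes> y = y" "y \<otimes> h = y"
      using regular_local_identity[OF B, of "{y}"] by auto
    then have hJ: "h \<in> J" "d \<otimes> h = \<zero>" "h \<otimes> d = \<zero>"
      by (auto simp: B_def)
    obtain p q where pq: "p \<in> C" "q \<in> C" "h \<otimes> p = p" "p \<otimes> h = p" "h \<otimes> q = q" "q \<otimes> h = q"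
        "p \<otimes> q = h" "q \<otimes> p = h" "y \<otimes> p \<otimes> y = y"
      using corner[folded J_def, OF hJ(1) h(2) y h(3,4)] by auto
    have [simp]: "h \<in> C" "p \<in> C" "q \<in> C"
      using J(1)[OF hJ(1)] pq by auto
    define W where "W = p \<oplus> (e \<ominus> h)"
    define W' where "W' = q \<oplus> (e \<ominus> h)"
    have [simp]: "W \<in> C" "W' \<in> C"
      by (simp_all add: W_def W'_def)
    have "\<iota> d * \<iota> d = \<iota> d" "\<iota> d * \<iota> h = 0" "\<iota> h * \<iota> d = 0" "\<iota> d * \<iota> e = \<iota> d" "\<iota> e * \<iota> d = \<iota> d"
      "\<iota> h * \<iota> h = \<iota> h" "\<iota> h * \<iota> e = \<iota> h" "\<iota> e * \<iota> h = \<iota> h" "\<iota> h * \<iota> y = \<iota> y" "\<iota> y * \<iota> h = \<iota> y"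
      "\<iota> h * \<iota> p = \<iota> p" "\<iota> p * \<iota> h = \<iota> p" "\<iota> h * \<iota> q = \<iota> q" "\<iota> q * \<iota> h = \<iota> q" "\<iota> p * \<iota> q = \<iota> h"
      "\<iota> q * \<iota> p = \<iota> h" "\<iota> y * \<iota> p * \<iota> y = \<iota> y" "\<iota> e * \<iota> e = \<iota> e"
      using dy hJ h(2-) pq(3-) e(2,3) by (simp_all add: emb(1,3)[symmetric])
    from orthogonal_sum_unit_regular[OF this]
    have W: "W \<otimes> W' = e" "W' \<otimes> W = e" "(d \<oplus> y) \<otimes> W \<otimes> (d \<oplus> y) = d \<oplus> y"
      by (simp_all add: W_def W'_def emb_eq_iff emb)
    define m where "m = u \<otimes> (e \<ominus> n)"
    define m' where "m' = (e \<oplus> n) \<otimes> v"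
    have [simp]: "m \<in> C" "m' \<in> C"
      by (simp_all add: m_def m'_def)
    have prod: "(a \<otimes> b) \<otimes> (b' \<otimes> a') = e" if "a \<in> C" "b \<in> C" "a' \<in> C" "b' \<in> C" "a \<otimes> a' = e" "b \<otimes> b' = e" for a b a' b'
    proof -
      have "(a \<otimes> b) \<otimes> (b' \<otimes> a') = a \<otimes> ((b \<otimes> b') \<otimes> a')"
        using that(1-4) by (simp add: mul_axioms(1))
      then show ?thesis
        using that e by simp
    qed
    have m: "m \<otimes> m' = e" "m' \<otimes> m = e"
      unfolding m_def m'_def by (rule prod; simp add: u n)+
    have sm: "x \<otimes> m = d \<oplus> y"
      using sn by (simp add: m_def s_def mul_axioms(1))
    have "(m \<otimes> W) \<otimes> (W' \<otimes> m') = e" "(W' \<otimes> m') \<otimes> (m \<otimes> W) = e"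
      by (rule prod; simp add: m W)+
    moreover have "x \<otimes> (m \<otimes> W) \<otimes> x = x"
    proof -
      \<comment> \<open>Writing the last factor \<open>x\<close> as
        \<open>x \<otimes> (m \<otimes> m')\<close> makes \<open>x\<close> occur only through
        \<open>x \<otimes> m = d \<oplus> y\<close>, of which \<open>W\<close> is an inner
        inverse.\<close>
      have "x \<otimes> (m \<otimes> W) \<otimes> x = x \<otimes> (m \<otimes> W) \<otimes> (x \<otimes> (m \<otimes> m'))"
        using e m by simp
      also have "\<dots> = (x \<otimes> m) \<otimes> W \<otimes> (x \<otimes> m) \<otimes> m'"
        by (simp add: mul_axioms(1))
      also have "\<dots> = x \<otimes> m \<otimes> m'"
        unfolding sm W(3) ..
      also have "\<dots> = x"
        using e m by (simp add: mul_axioms(1))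
      finally show ?thesis .
    qed
    ultimately show ?thesis
      by (intro bexI[of _ "m \<otimes> W"] conjI bexI[of _ "W' \<otimes> m'"]) simp_all
  qed
  then show ?thesis
    unfolding unital_unit_regular_def using e by (intro bexI[of _ e]) auto
qed

text \<open>An inner inverse of \<open>\<phi> x\<close> lifts to some \<open>y\<close> whose defect
  \<open>r\<close> lies in the kernel; \<open>regular_lift\<close> repairs it by terms from the
  kernel, which do not affect membership of the image in \<open>D\<close>.\<close>

lemma preimage_regular:
  assumes Q: "algebra Q" and hom: "alg_hom A Q \<phi>" and surj: "\<phi> ` C = carrier Q"
    and D: "subalgebra Q D" "regular_set Q D" and reg: "regular_set A (hom_kernel A Q \<phi>)"
  shows "regular_set A {x\<in>C. \<phi> x \<in> D}"
  unfolding regular_set_def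
proof
  note H = alg_homD[OF Q hom]
  note D' = subalgebraD[OF D(1)]
  fix x
  assume "x \<in> {x\<in>C. \<phi> x \<in> D}"
  then have x [simp]: "x \<in> C" "\<phi> x \<in> D"
    by auto
  then obtain a where a: "a \<in> D" "mul Q (mul Q (\<phi> x) a) (\<phi> x) = \<phi> x"
    using D(2)[unfolded regular_set_def, rule_format, OF x(2)] by auto
  have "a \<in> \<phi> ` C"
    using D'(1)[OF a(1)] surj by simp
  then obtain y where y [simp]: "y \<in> C" and \<phi>y: "\<phi> y = a"
    by auto
  define r where "r = x \<ominus> x \<otimes> y \<otimes> x"
  have "r \<in> hom_kernel A Q \<phi>"
    unfolding r_def using H a \<phi>y by (subst hom_kernel_iff[OF Q hom]) simp_all
  then obtain z where z: "z \<in> hom_kernel A Q \<phi>" "r \<otimes> z \<otimes> r = r"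
    using reg by (auto simp: regular_set_def)
  have [simp]: "z \<in> C" "r \<in> C"
    using z by (simp_all add: hom_kernel_def r_def)
  have ir: "\<iota> r = \<iota> x - \<iota> x * \<iota> y * \<iota> x"
    by (simp add: r_def emb)
  have "\<iota> r * \<iota> z * \<iota> r = \<iota> r"
    using z(2) by (simp add: emb(3)[symmetric])
  note id = regular_lift[OF this[unfolded ir]]
  define w where "w = y \<oplus> z \<ominus> y \<otimes> x \<otimes> z \<ominus> z \<otimes> x \<otimes> y \<oplus> y \<otimes> x \<otimes> z \<otimes> x \<otimes> y"
  have "x \<otimes> w \<otimes> x = x"
    using id by (simp add: w_def emb_eq_iff emb)
  moreover have "\<phi> z \<in> D" "\<phi> y \<in> D"
    using z(1) D'(2) a(1) \<phi>y by (simp_all add: hom_kernel_def)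
  then have "\<phi> w \<in> D"
    by (simp add: w_def H D')
  ultimately show "\<exists>y\<in>{x\<in>C. \<phi> x \<in> D}. x \<otimes> y \<otimes> x = x"
    by (intro bexI[of _ w]) (simp_all add: w_def)
qed

lemma locally_unit_regular_extension:
  assumes Q: "algebra Q" and hom: "alg_hom A Q \<phi>" and surj: "\<phi> ` C = carrier Q"
    and lur: "locally_unit_regular (A\<lparr>carrier := hom_kernel A Q \<phi>\<rparr>)" and fdss: "locally_fdss Q"
  shows "locally_unit_regular A"
  unfolding locally_unit_regular_def
proof (intro allI impI)
  fix F
  assume F: "finite F \<and> F \<subseteq> C"
  define J where "J = hom_kernel A Q \<phi>"
  note H = alg_homD[OF Q hom]
  have JI: "alg_ideal A J"
    unfolding J_def by (rule hom_kernel_ideal[OF Q hom])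
  note J = alg_idealD[OF JI]
  have regJ: "regular_set A J"
    using locally_unit_regular_ideal_regular[OF JI] lur by (simp add: J_def)
  have "finite (\<phi> ` F) \<and> \<phi> ` F \<subseteq> carrier Q"
    using F H(1) by auto
  then obtain D where D: "subalgebra Q D" "\<phi> ` F \<subseteq> D" "fd_semisimple (Q\<lparr>carrier := D\<rparr>)"
    using fdss[unfolded locally_fdss_def, rule_format, of "\<phi> ` F"] by auto
  note D' = subalgebraD[OF D(1)]
  have QD: "algebra (Q\<lparr>carrier := D\<rparr>)"
    by (intro algebra.intro algebra.subalgebra_is_algebra[OF Q D(1)])
  have urD: "unital_unit_regular (Q\<lparr>carrier := D\<rparr>)"
    by (rule algebra.semisimple_unit_regular[OF QD D(3)])
  then obtain \<epsilon> where \<epsilon>: "\<epsilon> \<in> D" "\<And>x. x \<in> D \<Longrightarrow> mul Q \<epsilon> x = x" "\<And>x. x \<in> D \<Longrightarrow> mul Q x \<epsilon> = x"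
    by (auto simp: unital_unit_regular_def)
  have regD: "regular_set Q D"
    using algebra.semisimple_regular[OF QD D(3)] by (simp add: regular_set_def)
  define R where "R = {x\<in>C. \<phi> x \<in> D}"
  have R: "subalgebra A R"
    using D' H by (auto simp: subalgebra_def R_def)
  have regR: "regular_set A R"
    unfolding R_def by (rule preimage_regular[OF Q hom surj D(1) regD regJ[unfolded J_def]])
  note R' = subalgebraD[OF R]
  have lift: "\<exists>x\<in>R. \<phi> x = a" if a: "a \<in> D" for a
  proof -
    have "a \<in> \<phi> ` C"
      using D'(1)[OF a] surj by simp
    then show ?thesis
      using a by (auto simp: R_def)
  qed
  \<comment> \<open>Adding \<open>l\<close> to \<open>F\<close> forces \<open>e\<close> to lift the
    identity of \<open>D\<close>: from \<open>e \<otimes> l = l\<close>, the product of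
    \<open>\<phi> e\<close> and \<open>\<epsilon>\<close> is \<open>\<epsilon>\<close>, while it is
    also \<open>\<phi> e\<close>.\<close>
  obtain l where l: "l \<in> R" "\<phi> l = \<epsilon>"
    using lift[OF \<epsilon>(1)] by auto
  have "finite (insert l F)" "insert l F \<subseteq> R"
    using F D(2) l by (auto simp: R_def)
  from regular_local_identity[OF R regR this]
  obtain e where e: "e \<in> R" "e \<otimes> e = e" "e \<otimes> l = l" "\<And>x. x \<in> F \<Longrightarrow> e \<otimes> x = x \<and> x \<otimes> e = x"
    by auto
  have [simp]: "e \<in> C" "\<phi> e \<in> D"
    using e(1) by (auto simp: R_def)
  have \<phi>e: "\<phi> e = \<epsilon>"
    using H(3)[of e l] e(3) l \<epsilon>(3)[of "\<phi> e"] R'(1) by simp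
  define S where "S = {x\<in>R. e \<otimes> x = x \<and> x \<otimes> e = x}"
  have SC: "x \<in> C" if "x \<in> S" for x
    using that R'(1) by (simp add: S_def)
  have S: "subalgebra A S"
    unfolding subalgebra_def
  proof (intro conjI ballI allI)
    show "S \<subseteq> C"
      using SC by auto
    show "\<zero> \<in> S"
      using R'(2) by (simp add: S_def)
    fix x y c
    assume "x \<in> S" and "y \<in> S"
    then have x: "x \<in> R" "x \<in> C" "e \<otimes> x = x" "x \<otimes> e = x" and y: "y \<in> R" "y \<in> C" "e \<otimes> y = y" "y \<otimes> e = y"
      using SC by (auto simp: S_def)
    show "x \<oplus> y \<in> S"
      using x y R'(3) by (simp add: S_def mul_axioms(2,3))
    show "x \<otimes> y \<in> S"
      using x y R'(6) mul_axioms(1)[of e x y] mul_axioms(1)[of x y e] by (simp add: S_def)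
  next
    fix x c
    assume "x \<in> S"
    then show "c \<cdot> x \<in> S"
      using R'(5) SC[of x] by (simp add: S_def smul_axioms(5,6))
  qed
  have "F \<subseteq> S"
    using e(4) \<open>insert l F \<subseteq> R\<close> by (auto simp: S_def)
  have AS: "algebra (A\<lparr>carrier := S\<rparr>)"
    by (intro algebra.intro subalgebra_is_algebra S)
  have homS: "alg_hom (A\<lparr>carrier := S\<rparr>) (Q\<lparr>carrier := D\<rparr>) \<phi>"
  proof -
    have "\<phi> x \<in> D" if "x \<in> S" for x
      using that by (simp add: S_def R_def)
    then show ?thesis
      using H(2-4) SC by (simp add: alg_hom_def)
  qed
  \<comment> \<open>Compression by \<open>e\<close> does not change the image in \<open>D\<close>,
    since \<open>\<phi> e\<close> is the identity there; so the corner still maps onto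
    \<open>D\<close>.\<close>
  have corner_S: "e \<otimes> x \<otimes> e \<in> S" if "x \<in> R" for x
  proof -
    have "e \<otimes> (e \<otimes> x \<otimes> e) = (e \<otimes> e) \<otimes> x \<otimes> e" "e \<otimes> x \<otimes> e \<otimes> e = e \<otimes> x \<otimes> (e \<otimes> e)"
      using R'(1)[OF that] by (simp_all add: mul_axioms(1))
    then show ?thesis
      using e(1,2) R'(6) that by (simp add: S_def)
  qed
  have surjS: "\<phi> ` S = D"
  proof
    show "\<phi> ` S \<subseteq> D"
      by (auto simp: S_def R_def)
    show "D \<subseteq> \<phi> ` S"
    proof
      fix a
      assume a: "a \<in> D"
      then obtain x where x: "x \<in> R" "\<phi> x = a"
        using lift by auto
      then have "\<phi> (e \<otimes> x \<otimes> e) = a"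
        using R'(1)[OF x(1)] H \<phi>e \<epsilon> a by simp
      then show "a \<in> \<phi> ` S"
        using corner_S[OF x(1)] by (intro image_eqI[of _ _ "e \<otimes> x \<otimes> e"]) simp_all
    qed
  qed
  have JR: "x \<in> R" if "x \<in> J" for x
    using that D'(2) by (simp add: J_def hom_kernel_def R_def)
  have kerS: "hom_kernel (A\<lparr>carrier := S\<rparr>) (Q\<lparr>carrier := D\<rparr>) \<phi> = J \<inter> S"
    using SC by (auto simp: hom_kernel_def J_def)
  have "regular_set A (J \<inter> S)"
    unfolding regular_set_def
  proof
    fix x
    assume "x \<in> J \<inter> S"
    then have x: "x \<in> J" "x \<in> S" "e \<otimes> x = x" "x \<otimes> e = x"
      by (auto simp: S_def)
    then obtain y where y: "y \<in> J" "x \<otimes> y \<otimes> x = x"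
      using regJ by (auto simp: regular_set_def)
    have [simp]: "x \<in> C" "y \<in> C"
      using J(1) x y by auto
    have "x \<otimes> (e \<otimes> y \<otimes> e) \<otimes> x = (x \<otimes> e) \<otimes> y \<otimes> (e \<otimes> x)"
      by (simp add: mul_axioms(1))
    then have "x \<otimes> (e \<otimes> y \<otimes> e) \<otimes> x = x"
      using x y by simp
    moreover have "e \<otimes> y \<otimes> e \<in> J \<inter> S"
      using corner_S[OF JR[OF y(1)]] J(6)[of e y] J(7)[of e "e \<otimes> y"] y(1) by simp
    ultimately show "\<exists>y\<in>J \<inter> S. x \<otimes> y \<otimes> x = x"
      by (intro bexI[of _ "e \<otimes> y \<otimes> e"])
  qed
  then have regS: "regular_set (A\<lparr>carrier := S\<rparr>) (hom_kernel (A\<lparr>carrier := S\<rparr>) (Q\<lparr>carrier := D\<rparr>) \<phi>)"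
    unfolding kerS by (simp add: regular_set_def)
  have cornerS: "\<exists>p\<in>S. \<exists>q\<in>S. h \<otimes> p = p \<and> p \<otimes> h = p \<and> h \<otimes> q = q \<and> q \<otimes> h = q \<and>
           p \<otimes> q = h \<and> q \<otimes> p = h \<and> y \<otimes> p \<otimes> y = y"
    if h: "h \<in> J \<inter> S" "h \<otimes> h = h" and y: "y \<in> J \<inter> S" "h \<otimes> y = y" "y \<otimes> h = y" for h y
  proof -
    have hy: "h \<in> J" "y \<in> J"
      using h y by auto
    obtain p q where pq: "p \<in> J" "q \<in> J" "h \<otimes> p = p" "p \<otimes> h = p" "h \<otimes> q = q" "q \<otimes> h = q"
        "p \<otimes> q = h" "q \<otimes> p = h" "y \<otimes> p \<otimes> y = y"
      using locally_unit_regular_corner[OF JI _ hy(1) h(2) hy(2) y(2,3)] lur by (auto simp: J_def)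
    \<comment> \<open>The corner of \<open>h\<close> lies inside that of \<open>e\<close>, because
      \<open>e\<close> fixes \<open>h\<close> on both sides.\<close>
    have "p \<in> S" if "p \<in> J" "h \<otimes> p = p" "p \<otimes> h = p" for p
    proof -
      have "e \<otimes> (h \<otimes> p) = e \<otimes> h \<otimes> p" "p \<otimes> h \<otimes> e = p \<otimes> (h \<otimes> e)"
        using J(1)[OF hy(1)] J(1)[OF that(1)] by (simp_all add: mul_axioms(1))
      then show ?thesis
        using that h(1) JR[OF that(1)] by (simp add: S_def)
    qed
    then have "p \<in> S" "q \<in> S"
      using pq by auto
    then show ?thesis
      using pq(3-) by (intro bexI[of _ p] bexI[of _ q] conjI)
  qed
  have eS: "e \<in> S"
    using e by (simp add: S_def)
  have idS: "e \<otimes> x = x" "x \<otimes> e = x" if "x \<in> S" for x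
    using that by (simp_all add: S_def)
  have fdD: "fin_dim (Q\<lparr>carrier := D\<rparr>)"
    using D(3) by (simp add: fd_semisimple_def)
  have "unital_unit_regular (A\<lparr>carrier := S\<rparr>)"
  proof (rule algebra.unital_extension_unit_regular[OF AS QD homS _ fdD urD _ _ _ regS, of e])
    fix h y
    assume "h \<in> hom_kernel (A\<lparr>carrier := S\<rparr>) (Q\<lparr>carrier := D\<rparr>) \<phi>"
      "mul (A\<lparr>carrier := S\<rparr>) h h = h" "y \<in> hom_kernel (A\<lparr>carrier := S\<rparr>) (Q\<lparr>carrier := D\<rparr>) \<phi>"
      "mul (A\<lparr>carrier := S\<rparr>) h y = y" "mul (A\<lparr>carrier := S\<rparr>) y h = y"
    then have "h \<in> J \<inter> S" "h \<otimes> h = h" "y \<in> J \<inter> S" "h \<otimes> y = y" "y \<otimes> h = y"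
      unfolding kerS by simp_all
    from cornerS[OF this]
    show "\<exists>p\<in>carrier (A\<lparr>carrier := S\<rparr>). \<exists>q\<in>carrier (A\<lparr>carrier := S\<rparr>).
          mul (A\<lparr>carrier := S\<rparr>) h p = p \<and> mul (A\<lparr>carrier := S\<rparr>) p h = p \<and>
          mul (A\<lparr>carrier := S\<rparr>) h q = q \<and> mul (A\<lparr>carrier := S\<rparr>) q h = q \<and>
          mul (A\<lparr>carrier := S\<rparr>) p q = h \<and> mul (A\<lparr>carrier := S\<rparr>) q p = h \<and>
          mul (A\<lparr>carrier := S\<rparr>) (mul (A\<lparr>carrier := S\<rparr>) y p) y = y"
      by simp
  qed (simp_all add: surjS eS idS)
  then show "\<exists>S. subalgebra A S \<and> F \<subseteq> S \<and> unital_unit_regular (A\<lparr>carrier := S\<rparr>)"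
    using S \<open>F \<subseteq> S\<close> by (intro exI[of _ S] conjI)
qed

section \<open>Quotients and transport along isomorphisms\<close>

lemma hom_image_algebra:
  assumes hom: "alg_hom A Q \<phi>" and surj: "\<phi> ` C = carrier Q" and zero: "\<phi> \<zero> = zero Q"
  shows "algebra Q"
proof -
  have H: "add Q (\<phi> x) (\<phi> y) = \<phi> (x \<oplus> y)" "mul Q (\<phi> x) (\<phi> y) = \<phi> (x \<otimes> y)" "smul Q c (\<phi> x) = \<phi> (c \<cdot> x)"
    if "x \<in> C" "y \<in> C" for x y c
    using hom that by (simp_all add: alg_hom_def)
  \<comment> \<open>The existence of negatives is the only existential axiom and gets an explicit
    witness; the other axioms are closure conditions or identities and pass directly to the
    image.\<close>
  have neg: "\<exists>y\<in>C. \<phi> (x \<oplus> y) = \<phi> \<zero>" if "x \<in> C" for x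
    using add_neg[OF that] closed(4)[OF that, of "- 1"] by (intro bexI[of _ "(- 1) \<cdot> x"]) simp_all
  show ?thesis
    unfolding algebra_def is_algebra_def surj[symmetric] zero[symmetric] ball_simps bex_simps
    by (intro conjI ballI allI)
       (simp_all add: H neg add_axioms(1,3) mul_axioms smul_axioms, simp add: add_axioms(2))
qed

lemma coset_eq:
  assumes J: "alg_ideal A J" and x: "x \<in> C"
  shows "coset A J x = {z\<in>C. z \<ominus> x \<in> J}"
proof -
  have "z \<in> C \<and> z \<ominus> x \<in> J" if "j \<in> J" "z = x \<oplus> j" for z j
  proof -
    have "x \<oplus> j \<ominus> x = j"
      using x alg_idealD(1)[OF J that(1)] by (simp add: emb_eq_iff emb)
    then show ?thesis
      using that x alg_idealD(1)[OF J that(1)] by simp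
  qed
  moreover have "\<exists>j. z = x \<oplus> j \<and> j \<in> J" if z: "z \<in> C" "z \<ominus> x \<in> J" for z
    using x z by (intro exI[of _ "z \<ominus> x"]) (simp add: emb_eq_iff emb)
  ultimately show ?thesis
    unfolding coset_def by auto
qed

lemma coset_eq_iff:
  assumes J: "alg_ideal A J" and x: "x \<in> C" and y: "y \<in> C"
  shows "coset A J x = coset A J y \<longleftrightarrow> x \<ominus> y \<in> J"
proof
  assume "coset A J x = coset A J y"
  moreover have "x \<ominus> x = \<zero>"
    using x by (simp add: emb_eq_iff emb)
  then have "x \<in> coset A J x"
    using x alg_idealD(2)[OF J] by (simp add: coset_eq[OF J])
  ultimately show "x \<ominus> y \<in> J"
    using y by (simp add: coset_eq[OF J])
next
  assume xy: "x \<ominus> y \<in> J"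
  have "z \<ominus> x \<in> J \<longleftrightarrow> z \<ominus> y \<in> J" if z: "z \<in> C" for z
  proof -
    have "z \<ominus> y = (z \<ominus> x) \<oplus> (x \<ominus> y)" "z \<ominus> x = (z \<ominus> y) \<ominus> (x \<ominus> y)"
      using x y z by (simp_all add: emb_eq_iff emb)
    then show ?thesis
      using alg_idealD(3,4)[OF J _ xy] by metis
  qed
  then show "coset A J x = coset A J y"
    using x y by (auto simp: coset_eq[OF J])
qed

lemma rep_coset:
  assumes J: "alg_ideal A J" and x: "x \<in> C"
  shows "rep (coset A J x) \<in> C" "rep (coset A J x) \<ominus> x \<in> J"
proof -
  have "x \<ominus> x = \<zero>"
    using x by (simp add: emb_eq_iff emb)
  then have "x \<in> coset A J x"
    using x alg_idealD(2)[OF J] by (simp add: coset_eq[OF J])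
  then have "rep (coset A J x) \<in> coset A J x"
    unfolding rep_def by (rule someI)
  then show "rep (coset A J x) \<in> C" "rep (coset A J x) \<ominus> x \<in> J"
    using x by (simp_all add: coset_eq[OF J])
qed

text \<open>The quotient operations use chosen representatives. These differ from \<open>x\<close>
  and \<open>y\<close> by elements of \<open>J\<close>, and for products the error is \<open>(x'
  \<ominus> x) \<otimes> y' \<oplus> x \<otimes> (y' \<ominus> y)\<close>, again in
  \<open>J\<close>.\<close>

lemma coset_hom:
  assumes J: "alg_ideal A J"
  shows "alg_hom A (quotient_alg A J) (coset A J)"
proof -
  note c = alg_idealD[OF J]
  have "coset A J (x \<oplus> y) = coset A J (rep (coset A J x) \<oplus> rep (coset A J y))"
    "coset A J (x \<otimes> y) = coset A J (rep (coset A J x) \<otimes> rep (coset A J y))"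
    "coset A J (c \<cdot> x) = coset A J (c \<cdot> rep (coset A J x))"
    if [simp]: "x \<in> C" "y \<in> C" for x y c
  proof -
    define x' y' where "x' = rep (coset A J x)" and "y' = rep (coset A J y)"
    have [simp]: "x' \<in> C" "y' \<in> C" and d: "x' \<ominus> x \<in> J" "y' \<ominus> y \<in> J"
      using rep_coset[OF J] by (simp_all add: x'_def y'_def)
    have "x' \<oplus> y' \<ominus> (x \<oplus> y) = (x' \<ominus> x) \<oplus> (y' \<ominus> y)"
      by (simp add: emb_eq_iff emb)
    then show "coset A J (x \<oplus> y) = coset A J (rep (coset A J x) \<oplus> rep (coset A J y))"
      unfolding x'_def[symmetric] y'_def[symmetric]
      using c(3)[OF d] coset_eq_iff[OF J, of "x' \<oplus> y'" "x \<oplus> y"] by simp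
    have "x' \<otimes> y' \<ominus> x \<otimes> y = (x' \<ominus> x) \<otimes> y' \<oplus> x \<otimes> (y' \<ominus> y)"
      by (simp add: emb_eq_iff emb algebra_simps)
    then show "coset A J (x \<otimes> y) = coset A J (rep (coset A J x) \<otimes> rep (coset A J y))"
      unfolding x'_def[symmetric] y'_def[symmetric]
      using c(3)[OF c(7)[OF _ d(1)] c(6)[OF _ d(2)], of y' x]
        coset_eq_iff[OF J, of "x' \<otimes> y'" "x \<otimes> y"] by simp
    have "c \<cdot> x' \<ominus> c \<cdot> x = c \<cdot> (x' \<ominus> x)"
      using smul_axioms(3)[of x "- 1" c] smul_axioms(3)[of x c "- 1"] by (simp add: diff_def smul_axioms(1))
    then show "coset A J (c \<cdot> x) = coset A J (c \<cdot> rep (coset A J x))"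
      unfolding x'_def[symmetric]
      using c(5)[OF d(1), of c] coset_eq_iff[OF J, of "c \<cdot> x'" "c \<cdot> x"] by simp
  qed
  then show ?thesis
    by (simp add: alg_hom_def quotient_alg_def)
qed

lemma quotient_algebra:
  assumes J: "alg_ideal A J"
  shows "algebra (quotient_alg A J)"
  by (rule hom_image_algebra[OF coset_hom[OF J]]) (simp_all add: quotient_alg_def)

lemma coset_kernel:
  assumes J: "alg_ideal A J"
  shows "hom_kernel A (quotient_alg A J) (coset A J) = J"
  using alg_idealD(1)[OF J] coset_eq_iff[OF J, of _ \<zero>]
  by (auto simp: hom_kernel_def quotient_alg_def)

lemma locally_unit_regular_iso:
  assumes B: "algebra B" and iso: "alg_iso A B f" and lur: "locally_unit_regular A"
  shows "locally_unit_regular B"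
  unfolding locally_unit_regular_def
proof (intro allI impI)
  have bij: "bij_betw f C (carrier B)" and hom: "alg_hom A B f"
    using iso by (auto simp: alg_iso_def alg_hom_def bij_betw_def)
  note H = alg_homD[OF B hom]
  fix F
  assume F: "finite F \<and> F \<subseteq> carrier B"
  then obtain F' where F': "F' \<subseteq> C" "finite F'" "F = f ` F'"
    using bij finite_subset_image[of F f C] by (auto simp: bij_betw_def)
  then obtain S where S: "subalgebra A S" "F' \<subseteq> S" "unital_unit_regular (A\<lparr>carrier := S\<rparr>)"
    using lur[unfolded locally_unit_regular_def, rule_format, of F'] by auto
  note c = subalgebraD[OF S(1)]
  have H': "add B (f x) (f y) = f (x \<oplus> y)" "mul B (f x) (f y) = f (x \<otimes> y)" "smul B a (f x) = f (a \<cdot> x)"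
    if "x \<in> S" "y \<in> S" for x y a
    using H c(1) that by simp_all
  have "subalgebra B (f ` S)"
    unfolding subalgebra_def ball_simps
  proof (intro conjI ballI allI)
    show "f ` S \<subseteq> carrier B"
      using H(1) c(1) by auto
    show "zero B \<in> f ` S"
      using H(6) c(2) by (intro image_eqI[of _ _ \<zero>]) simp_all
  qed (simp_all add: H' c)
  moreover have "F \<subseteq> f ` S"
    using F' S(2) by auto
  moreover obtain e where e: "e \<in> S" "\<And>x. x \<in> S \<Longrightarrow> e \<otimes> x = x" "\<And>x. x \<in> S \<Longrightarrow> x \<otimes> e = x"
    and ur: "\<And>x. x \<in> S \<Longrightarrow> \<exists>u\<in>S. (\<exists>v\<in>S. u \<otimes> v = e \<and> v \<otimes> u = e) \<and> x \<otimes> u \<otimes> x = x"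
    using S(3) by (auto simp: unital_unit_regular_def)
  have ur': "\<exists>u\<in>S. (\<exists>v\<in>S. mul B (f u) (f v) = f e \<and> mul B (f v) (f u) = f e) \<and>
      mul B (mul B (f x) (f u)) (f x) = f x" if x: "x \<in> S" for x
  proof -
    obtain u where u: "u \<in> S" "\<exists>v\<in>S. u \<otimes> v = e \<and> v \<otimes> u = e" "x \<otimes> u \<otimes> x = x"
      using ur[OF x] by auto
    then obtain v where "v \<in> S" "u \<otimes> v = e" "v \<otimes> u = e"
      by auto
    then show ?thesis
      using u(1,3) x c(6) by (intro bexI[of _ u] conjI bexI[of _ v]) (simp_all add: H')
  qed
  have id: "mul B (f e) (f x) = f x" "mul B (f x) (f e) = f x" if "x \<in> S" for x
    using e that by (simp_all add: H')
  have "unital_unit_regular (B\<lparr>carrier := f ` S\<rparr>)"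
    unfolding unital_unit_regular_def using e(1) by (intro bexI[of _ "f e"]) (simp_all add: id ur')
  ultimately show "\<exists>S. subalgebra B S \<and> F \<subseteq> S \<and> unital_unit_regular (B\<lparr>carrier := S\<rparr>)"
    by (intro exI[of _ "f ` S"] conjI)
qed

end

theorem theorem5p6:
  shows "(\<forall>(R :: ('k::field, 'a) alg) J.
            is_algebra R \<and> alg_ideal R J \<and>
            locally_unit_regular (R\<lparr>carrier := J\<rparr>) \<and>
            locally_fdss (quotient_alg R J)
            \<longrightarrow> locally_unit_regular R)
       \<and> (\<forall>(A :: ('k, 'b) alg) (B :: ('k, 'c) alg) (C :: ('k, 'd) alg).
            is_algebra A \<and> is_algebra C \<and> locally_fdss A \<and> locally_fdss C \<and>
            is_extension A B C \<longrightarrow> locally_unit_regular B)"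
proof (intro conjI allI impI; elim conjE)
  fix R :: "('k, 'a) alg" and J
  assume R: "is_algebra R" and J: "alg_ideal R J"
    and lur: "locally_unit_regular (R\<lparr>carrier := J\<rparr>)" and fdss: "locally_fdss (quotient_alg R J)"
  note R' = algebra.intro[OF R]
  show "locally_unit_regular R"
    using algebra.locally_unit_regular_extension[OF R' algebra.quotient_algebra[OF R' J]
        algebra.coset_hom[OF R' J] _ _ fdss]
    by (simp add: algebra.coset_kernel[OF R' J] lur) (simp add: quotient_alg_def)
next
  fix A :: "('k, 'b) alg" and B :: "('k, 'c) alg" and C :: "('k, 'd) alg"
  assume A: "is_algebra A" and C: "is_algebra C" and fdss: "locally_fdss A" "locally_fdss C"
    and "is_extension A B C"
  then obtain J f g where B: "is_algebra B" and J: "alg_ideal B J"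
    and f: "alg_iso A (B\<lparr>carrier := J\<rparr>) f" and g: "alg_iso (quotient_alg B J) C g"
    by (auto simp: is_extension_def)
  note A' = algebra.intro[OF A] and B' = algebra.intro[OF B] and C' = algebra.intro[OF C]
  note Q = algebra.quotient_algebra[OF B' J]
  have JB: "algebra (B\<lparr>carrier := J\<rparr>)"
    by (intro algebra.intro algebra.subalgebra_is_algebra[OF B'] alg_ideal_subalgebra J)
  have lur: "locally_unit_regular (B\<lparr>carrier := J\<rparr>)"
    by (rule algebra.locally_unit_regular_iso[OF A' JB f
          algebra.locally_fdss_imp_locally_unit_regular[OF A' fdss(1)]])
  \<comment> \<open>With \<open>C\<close> as the target, its local semisimplicity applies directly
    instead of being carried back along \<open>g\<close>. Injectivity of \<open>g\<close> keeps the
    kernel equal to \<open>J\<close>.\<close>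
  define \<phi> where "\<phi> = g \<circ> coset B J"
  have ghom: "alg_hom (quotient_alg B J) C g" and ginj: "inj_on g (carrier (quotient_alg B J))"
    and gsurj: "g ` carrier (quotient_alg B J) = carrier C"
    using g by (auto simp: alg_iso_def alg_hom_def bij_betw_def)
  note G = algebra.alg_homD[OF Q C' ghom] and H = algebra.alg_homD[OF B' Q algebra.coset_hom[OF B' J]]
  have "alg_hom B C \<phi>"
    using G H by (simp add: alg_hom_def \<phi>_def)
  moreover have "\<phi> ` carrier B = carrier C"
    using gsurj by (simp add: \<phi>_def quotient_alg_def image_image comp_def)
  moreover have "hom_kernel B C \<phi> = hom_kernel B (quotient_alg B J) (coset B J)"
    using inj_on_eq_iff[OF ginj H(1) algebra.closed(1)[OF Q]] G(6) by (auto simp: hom_kernel_def \<phi>_def)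
  ultimately show "locally_unit_regular B"
    using algebra.locally_unit_regular_extension[OF B' C' _ _ _ fdss(2), of \<phi>] lur
    by (simp add: algebra.coset_kernel[OF B' J])
qed

end
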